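(* There exist measures $\mu_1,\mu_2,\mu_3$ on $\mathbb{R}$ for which both of the following hold: (1) The mapping $m\mapsto\nu^m$, where $\nu^m$ is the minimizer of $\nu\mapsto\sum_{j=1}^3\mathcal{MK}^2_{2,m}(\mu_j,\nu)$ over $\mathcal{P}^m_{ac}$, is not monotone, in the sense that there exist $0<m<\bar m<\min_{j=1,2,3}\mathcal{M}(\mu_j)$ for which $\nu^m$ is not a submeasure of $\nu^{\bar m}$ (i.e. $\nu^m\not\le\nu^{\bar m}$). (2) The mapping $m\mapsto\mu^m_{3\le}:=(\pi_3)_\#\sigma_m$, where $\sigma_m\in\mathrm{Opt}_m(\mu_1,\mu_2,\mu_3)$, is not monotone, in the sense that there exist $0<m<\bar m<\min_{j=1,2,3}\mathcal{M}(\mu_j)$ for which $\mu^m_{3\le}$ is not a submeasure of $\mu^{\bar m}_{3\le}$.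
   Context: "Measure" means positive Borel measure; every measure on $\mathbb{R}^n$ is assumed to have finite second moment, and the $\mu_j$ have finite total mass. $\mathcal{M}(\mu)$ is the total mass of $\mu$. For measures, $\mu'\le\mu$ ("$\mu'$ is a submeasure of $\mu$") means $\mu'(E)\le\mu(E)$ for all measurable $E$. $\pi_j$ is projection onto the $j$th coordinate. $\mathcal{P}^m_{ac}$ is the set of Lebesgue-absolutely continuous measures $\nu$ (here on $\mathbb{R}$) with $\mathcal{M}(\nu)=m$ and $\int|x|^2\,\nu(dx)<\infty$. $\Pi_{\le}(\mu,\nu)$ is the set of measures $\gamma$ on the product space with $(\pi_1)_\#\gamma\le\mu$ and $(\pi_2)_\#\gamma\le\nu$, and $$\mathcal{MK}^2_{2,m}(\mu,\nu):=\min_{\gamma\in\Pi_{\le}(\mu,\nu),\ \mathcal{M}(\gamma)=m}\int|x-y|^2\,\gamma(dx,dy).$$ $\Pi_{\le}(\mu_1,\mu_2,\mu_3)$ is the set of measures on $\mathbb{R}^3$ whose $j$th marginal is $\le\mu_j$ for each $j$, and $\mathrm{Opt}_m(\mu_1,\mu_2,\mu_3)$ is the set of minimizers of $\int\sum_{j\ne k}|x_j-x_k|^2\,\sigma(dx_1,dx_2,dx_3)$ over $\sigma\in\Pi_{\le}(\mu_1,\mu_2,\mu_3)$ with $\mathcal{M}(\sigma)=m$. *)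

theory Defs
  imports "HOL-Analysis.Analysis"
begin

text \<open>
  All measures below are Borel measures, i.e. \<open>sets \<mu> = sets borel\<close>.  On measures with the same
  measurable sets, the library order \<open>\<le>\<close> is setwise comparison (\<open>le_measure_iff\<close>), so \<open>\<mu>' \<le> \<mu>\<close> says
  that \<open>\<mu>'\<close> is a submeasure of \<open>\<mu>\<close>.
\<close>

definition mass :: "'a measure \<Rightarrow> ennreal" where
  "mass \<mu> = emeasure \<mu> (space \<mu>)"

definition second_moment :: "'a::euclidean_space measure \<Rightarrow> ennreal" where
  "second_moment \<mu> = (\<integral>\<^sup>+x. ennreal ((norm x)\<^sup>2) \<partial>\<mu>)"

definition P_ac :: "real \<Rightarrow> real measure set" where
  "P_ac m = {\<nu>. sets \<nu> = sets borel \<and> absolutely_continuous lborel \<nu> \<and>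
                mass \<nu> = ennreal m \<and> second_moment \<nu> < \<infinity>}"

text \<open>
  In \<open>partial_couplings2\<close> and \<open>partial_couplings3\<close> a finite second moment need not be demanded:
  it is inherited from the marginals, since \<open>\<bar>x\<bar>\<^sup>2\<close> is the sum of the squared coordinates.
\<close>

definition partial_couplings2 ::
    "real measure \<Rightarrow> real measure \<Rightarrow> (real \<times> real) measure set" where
  "partial_couplings2 \<mu> \<nu> =
     {\<gamma>. sets \<gamma> = sets borel \<and> distr \<gamma> borel fst \<le> \<mu> \<and> distr \<gamma> borel snd \<le> \<nu>}"

definition MK2 :: "real \<Rightarrow> real measure \<Rightarrow> real measure \<Rightarrow> ennreal" where
  "MK2 m \<mu> \<nu> =
     (INF \<gamma>\<in>{\<gamma> \<in> partial_couplings2 \<mu> \<nu>. mass \<gamma> = ennreal m}.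
        \<integral>\<^sup>+(x, y). ennreal (\<bar>x - y\<bar>\<^sup>2) \<partial>\<gamma>)"

definition partial_barycenters :: "(3 \<Rightarrow> real measure) \<Rightarrow> real \<Rightarrow> real measure set" where
  "partial_barycenters \<mu> m =
     {\<nu>. is_arg_min (\<lambda>\<nu>. \<Sum>j\<in>UNIV. MK2 m (\<mu> j) \<nu>) (\<lambda>\<nu>. \<nu> \<in> P_ac m) \<nu>}"

definition partial_couplings3 :: "(3 \<Rightarrow> real measure) \<Rightarrow> (real ^ 3) measure set" where
  "partial_couplings3 \<mu> =
     {\<sigma>. sets \<sigma> = sets borel \<and> (\<forall>j. distr \<sigma> borel (\<lambda>x. x $ j) \<le> \<mu> j)}"

definition Opt :: "real \<Rightarrow> (3 \<Rightarrow> real measure) \<Rightarrow> (real ^ 3) measure set" where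
  "Opt m \<mu> =
     {\<sigma>. is_arg_min
           (\<lambda>\<sigma>. \<integral>\<^sup>+x. ennreal (\<Sum>j\<in>UNIV. \<Sum>k\<in>UNIV - {j}. \<bar>x $ j - x $ k\<bar>\<^sup>2) \<partial>\<sigma>)
           (\<lambda>\<sigma>. \<sigma> \<in> partial_couplings3 \<mu> \<and> mass \<sigma> = ennreal m) \<sigma>}"

end

theory Submission
  imports Defs
begin

text \<open>
  The three measures are push-forwards of Lebesgue measure on \<open>[0,3)\<close>: the interval \<open>[0,3)\<close> itself,
  \<open>\<delta>\<^sub>0 + 2\<delta>\<^sub>-\<^sub>2\<close>, and \<open>\<delta>\<^sub>-\<^sub>1 + \<delta>\<^sub>0 + \<delta>\<^sub>1\<close>.  At mass 1 it is cheapest to match \<open>[0,1)\<close> with the atom 0 of the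
  second measure, hence with the atom 0 of the third.  At mass 2 the interval \<open>[1,2)\<close> competes for the
  atom 0 of the second measure and pushes \<open>[0,1)\<close> to \<open>-2\<close>; the midpoints move, \<open>[0,1)\<close> now prefers the
  atom \<open>-1\<close> of the third measure and \<open>[1,2)\<close> the atom 1, and the atom 0 of the third measure is abandoned.

  Optimality and uniqueness come from linear programming duality.  Prices \<open>p j \<ge> 0\<close> on the unused
  capacity and a value \<open>l\<close> per unit of mass with \<open>(\<Sum>j. (x j - y)\<^sup>2 + p j (x j)) \<ge> l\<close> bound both problems
  from below, because the cost of \<open>Opt\<close> is 6 times the sum of squared deviations from the mean.
\<close>

section \<open>Comparing measures and deducing their equality from inequalities\<close>

lemma nn_integral_mono_measure_le:
  assumes "sets M = sets N" "M \<le> N"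
  shows "integral\<^sup>N M f \<le> integral\<^sup>N N f"
proof -
  have sp: "space M = space N" using assms(1) by (rule sets_eq_imp_space_eq)
  have le: "emeasure M A \<le> emeasure N A" for A
    using assms sp by (simp add: le_measure_iff le_fun_def)
  have sf: "simple_function N g" if "simple_function M g" for g :: "'a \<Rightarrow> ennreal"
    using that assms(1) sp by (simp add: simple_function_def)
  have "integral\<^sup>S M g \<le> integral\<^sup>S N g" for g
    unfolding simple_integral_def sp by (intro sum_mono mult_left_mono le) auto
  with sf show ?thesis
    unfolding nn_integral_def by (intro SUP_mono) blast
qed

lemma AE_measure_le:
  assumes "sets M = sets N" "M \<le> N" "AE x in N. P x"
  shows "AE x in M. P x"
proof -
  have sp: "space M = space N" using assms(1) by (rule sets_eq_imp_space_eq)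
  have le: "emeasure M A \<le> emeasure N A" for A
    using assms(1,2) sp by (simp add: le_measure_iff le_fun_def)
  from assms(3) obtain Z where "{x\<in>space N. \<not> P x} \<subseteq> Z" "Z \<in> null_sets N"
    by (auto elim: AE_E simp: null_sets_def)
  moreover have "Z \<in> null_sets M"
    using calculation(2) le[of Z] assms(1) by (simp add: null_sets_def)
  ultimately show ?thesis using sp by (metis AE_I')
qed

text \<open>Applied to complements and subtracted from the common finite mass, the inequality
  reverses.\<close>

lemma measure_eqI_le_finite:
  assumes "sets M = sets N" "\<And>A. A \<in> sets M \<Longrightarrow> emeasure M A \<le> emeasure N A"
    and "emeasure M (space M) = emeasure N (space N)" "emeasure N (space N) < \<infinity>"
  shows "M = N"
proof (rule measure_eqI[OF assms(1)])
  fix A assume A: "A \<in> sets M"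
  have sp: "space M = space N" using assms(1) by (rule sets_eq_imp_space_eq)
  let ?B = "space M - A"
  have B: "?B \<in> sets M" using A by auto
  have M: "emeasure M A + emeasure M ?B = emeasure M (space M)"
    using A B by (subst plus_emeasure) (auto simp: Un_absorb1 sets.sets_into_space)
  have N: "emeasure N A + emeasure N ?B = emeasure N (space N)"
    using A B assms(1) sp by (subst plus_emeasure) (auto simp: Un_absorb1 sets.sets_into_space)
  have fin: "emeasure N ?B < \<infinity>"
    using assms(4) N by (metis ennreal_add_eq_top infinity_ennreal_def less_top)
  have "emeasure N A + emeasure N ?B = emeasure M A + emeasure M ?B"
    using M N assms(3) by simp
  also have "\<dots> \<le> emeasure M A + emeasure N ?B"
    using assms(2)[OF B] by (intro add_left_mono)
  finally have "emeasure N A \<le> emeasure M A"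
    using fin by (auto simp: add.commute[of _ "emeasure N ?B"] ennreal_add_left_cancel_le)
  then show "emeasure M A = emeasure N A"
    using assms(2)[OF A] by (rule antisym[rotated])
qed

text \<open>Inner regularity carries the inequality from compact sets to Borel sets. The uniqueness
  proof can compare measures on compact sets only, because it needs an infimum over targets to be
  attained.\<close>

lemma measure_eqI_le_compact:
  fixes M N :: "real measure"
  assumes [simp]: "sets M = sets borel" "sets N = sets borel"
    and le: "\<And>K. compact K \<Longrightarrow> emeasure M K \<le> emeasure N K"
    and mass: "emeasure M (space M) = emeasure N (space N)" "emeasure N (space N) < \<infinity>"
  shows "M = N"
proof (rule measure_eqI_le_finite)
  fix B assume B: "B \<in> sets M"
  have "emeasure M B = (SUP K \<in> {K. K \<subseteq> B \<and> compact K}. emeasure M K)"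
    using B mass by (intro inner_regular) auto
  also have "\<dots> \<le> emeasure N B"
  proof (rule SUP_least)
    fix K assume "K \<in> {K. K \<subseteq> B \<and> compact K}"
    then show "emeasure M K \<le> emeasure N B"
      using le[of K] emeasure_mono[of K B N] B by (auto intro: order.trans)
  qed
  finally show "emeasure M B \<le> emeasure N B" .
qed (use mass in auto)

section \<open>Measurability, Lebesgue measure on intervals, elementary facts on costs and
  couplings\<close>

lemma borel_measurable_vec_nth [measurable]: "(\<lambda>x :: real^'n. x $ j) \<in> borel_measurable borel"
  by (intro borel_measurable_continuous_onI continuous_intros)

lemma borel_measurable_vec_lambda:
  fixes f :: "'a \<Rightarrow> 'n::finite \<Rightarrow> real"
  assumes "\<And>j. (\<lambda>x. f x j) \<in> borel_measurable M"
  shows "(\<lambda>x. \<chi> j. f x j) \<in> borel_measurable M"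
  using assms by (subst borel_measurable_euclidean_space)
    (auto simp: Basis_vec_def inner_axis)

text \<open>A density instead of a restricted space, so that the underlying space stays
  \<open>UNIV\<close> and push-forwards remain ordinary Borel measures.\<close>

definition leb :: "real set \<Rightarrow> real measure" where
  "leb I = density lborel (indicator I)"

lemma sets_leb [simp, measurable_cong]: "sets (leb I) = sets borel"
  and space_leb [simp]: "space (leb I) = UNIV"
  by (simp_all add: leb_def)

lemma emeasure_leb: "I \<in> sets borel \<Longrightarrow> E \<in> sets borel \<Longrightarrow> emeasure (leb I) E = emeasure lborel (I \<inter> E)"
  by (simp add: leb_def emeasure_restricted)

lemma nn_integral_leb:
  "I \<in> sets borel \<Longrightarrow> f \<in> borel_measurable borel \<Longrightarrow>
    integral\<^sup>N (leb I) f = (\<integral>\<^sup>+x. f x * indicator I x \<partial>lborel)"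
  by (simp add: leb_def nn_integral_density mult.commute)

lemma AE_leb: "I \<in> sets borel \<Longrightarrow> (AE x in leb I. P x) \<longleftrightarrow> (AE x in lborel. x \<in> I \<longrightarrow> P x)"
  unfolding leb_def by (subst AE_density) (auto simp: indicator_def)

text \<open>Translation invariance. It brings windows with different starting points back to the
  common parameter interval \<open>{0..<m}\<close>.\<close>

lemma nn_integral_leb_shift:
  fixes k m :: real
  assumes [measurable]: "f \<in> borel_measurable borel"
  shows "integral\<^sup>N (leb {k..<k+m}) f = (\<integral>\<^sup>+a. f (a + k) \<partial>leb {0..<m})"
proof -
  have "integral\<^sup>N (leb {k..<k+m}) f = (\<integral>\<^sup>+x. f x * indicator {k..<k+m} x \<partial>lborel)"
    by (simp add: nn_integral_leb)
  also have "\<dots> = (\<integral>\<^sup>+a. f (a+k) * indicator {0..<m} a \<partial>lborel)"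
    by (subst nn_integral_real_affine[where c=1 and t=k])
      (auto intro!: nn_integral_cong simp: indicator_def add.commute)
  also have "\<dots> = (\<integral>\<^sup>+a. f (a + k) \<partial>leb {0..<m})"
    by (simp add: nn_integral_leb)
  finally show ?thesis .
qed

lemma borel_measurable_fst [measurable]: "(fst :: real \<times> real \<Rightarrow> real) \<in> borel_measurable borel"
  and borel_measurable_snd [measurable]: "(snd :: real \<times> real \<Rightarrow> real) \<in> borel_measurable borel"
  by (auto intro!: borel_measurable_continuous_onI continuous_intros)

text \<open>For n points the squared distances over ordered pairs add up to 2n times the squared
  deviations from the mean; here n = 3. The cost of \<open>Opt\<close> thus becomes the cost of
  moving all three coordinates to one common point.\<close>

lemma sum_sqdist_eq_mean:
  fixes x :: "3 \<Rightarrow> real"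
  shows "(\<Sum>j\<in>UNIV. \<Sum>k\<in>UNIV - {j}. (x j - x k)\<^sup>2)
    = 6 * (\<Sum>j\<in>UNIV. (x j - (\<Sum>i\<in>UNIV. x i) / 3)\<^sup>2)"
  by (simp add: sum_diff1 sum_3) (simp add: power2_eq_square field_simps)

lemma partial_couplings2_snd:
  assumes "\<gamma> \<in> partial_couplings2 \<mu> \<nu>" "sets \<nu> = sets borel" "mass \<gamma> = mass \<nu>" "mass \<nu> < \<infinity>"
  shows "distr \<gamma> borel snd = \<nu>"
proof (rule measure_eqI_le_finite)
  have s: "sets \<gamma> = sets borel" "distr \<gamma> borel snd \<le> \<nu>"
    using assms(1) by (auto simp: partial_couplings2_def)
  have sp: "space \<gamma> = UNIV" "space \<nu> = UNIV"
    using sets_eq_imp_space_eq[OF s(1)] sets_eq_imp_space_eq[OF assms(2)] by auto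
  have [measurable_cong]: "sets \<gamma> = sets borel" by (rule s(1))
  show "emeasure (distr \<gamma> borel snd) E \<le> emeasure \<nu> E" for E
    using s(2) sp assms(2) by (simp add: le_measure_iff le_fun_def)
  show "emeasure (distr \<gamma> borel snd) (space (distr \<gamma> borel snd)) = emeasure \<nu> (space \<nu>)"
    using assms(3) sp by (simp add: emeasure_distr mass_def)
qed (use assms in \<open>auto simp: mass_def\<close>)

lemma distr_leI:
  assumes "f \<in> measurable N borel" "sets \<mu> = sets borel"
    and "\<And>E. E \<in> sets borel \<Longrightarrow> emeasure (distr N borel f) E \<le> emeasure \<mu> E"
  shows "distr N borel f \<le> \<mu>"
  using assms sets_eq_imp_space_eq[OF assms(2)]
  by (auto simp: le_measure_iff le_fun_def) (metis assms(2) emeasure_notin_sets le_zero_eq sets_distr order_refl)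

section \<open>Duality for both problems from an abstract certificate\<close>

text \<open>
  \<open>S j\<close> pushes Lebesgue measure on \<open>[0,M)\<close> to the \<open>j\<close>-th measure.  The optimal plan of mass \<open>m\<close> sends
  \<open>a \<in> [0,m)\<close> to the point with coordinates \<open>S j (a + k j)\<close>, so it uses the window \<open>[k j, k j + m)\<close> of the
  \<open>j\<close>-th measure, outside of which the price \<open>p j\<close> must vanish.  The conjugates \<open>psi j\<close> bound the cost of
  reaching \<open>y\<close> from the atomic measures \<open>j \<noteq> 1\<close>; \<open>A j\<close> carries the \<open>j\<close>-th measure, and \<open>X\<close> collects the
  ties of the dual problem.
\<close>

locale dual_certificate =
  fixes S :: "3 \<Rightarrow> real \<Rightarrow> real" and A :: "3 \<Rightarrow> real set" and M m l R :: real
    and k :: "3 \<Rightarrow> real" and p psi :: "3 \<Rightarrow> real \<Rightarrow> real" and X :: "real set"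
  assumes S_meas [measurable]: "\<And>j. S j \<in> borel_measurable borel"
    and A_meas [measurable]: "\<And>j. A j \<in> sets borel"
    and S_A: "\<And>j a. a \<in> {0..<M} \<Longrightarrow> S j a \<in> A j"
    and S_bounded: "\<And>j a. a \<in> {0..<M} \<Longrightarrow> \<bar>S j a\<bar> \<le> R"
    and S1: "S 1 = (\<lambda>a. a)" and k1: "k 1 = 0" and A1: "A 1 = {0..<M}"
    and m_pos: "0 < m" and k_nonneg: "\<And>j. 0 \<le> k j" and k_le: "\<And>j. k j + m \<le> M"
    and p_meas [measurable]: "\<And>j. p j \<in> borel_measurable borel"
    and p_cont: "continuous_on UNIV (p 1)"
    and p_nonneg: "\<And>j x. 0 \<le> p j x"
    and slack: "\<And>j a. a \<in> {0..<M} \<Longrightarrow> a \<notin> {k j..<k j + m} \<Longrightarrow> p j (S j a) = 0"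
    and psi_cont: "\<And>j. continuous_on UNIV (psi j)"
    and psi_nonneg: "\<And>j y. 0 \<le> psi j y"
    and psi_le: "\<And>j x y. j \<noteq> 1 \<Longrightarrow> x \<in> A j \<Longrightarrow> psi j y \<le> (x - y)\<^sup>2 + p j x"
    and dual_le: "\<And>a y. a \<in> {0..<M} \<Longrightarrow> l \<le> (a - y)\<^sup>2 + p 1 a + psi 2 y + psi 3 y"
    and dual_eqD: "\<And>a y. a \<in> {0..<M} \<Longrightarrow> a \<notin> X \<Longrightarrow> (a - y)\<^sup>2 + p 1 a + psi 2 y + psi 3 y = l
      \<Longrightarrow> a < m \<and> y = (\<Sum>j\<in>UNIV. S j (a + k j)) / 3"
    and X_fin: "finite X"
    and tight: "\<And>a. a \<in> {0..<m} \<Longrightarrow>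
      (\<Sum>j\<in>UNIV. (S j (a + k j) - (\<Sum>j\<in>UNIV. S j (a + k j)) / 3)\<^sup>2 + p j (S j (a + k j))) = l"
    and null_vimage: "\<And>N. N \<in> null_sets lborel \<Longrightarrow>
      {a \<in> {0..<m}. (\<Sum>j\<in>UNIV. S j (a + k j)) / 3 \<in> N} \<in> null_sets lborel"
begin

definition bar :: "real \<Rightarrow> real" where
  "bar a = (\<Sum>j\<in>UNIV. S j (a + k j)) / 3"

definition mu :: "3 \<Rightarrow> real measure" where
  "mu j = distr (leb {0..<M}) borel (S j)"

definition nu :: "real measure" where
  "nu = distr (leb {0..<m}) borel bar"

definition plan :: "(real ^ 3) measure" where
  "plan = distr (leb {0..<m}) borel (\<lambda>a. \<chi> j. S j (a + k j))"

text \<open>Slack in the dual constraint: nonnegative for a in \<open>{0..<M}\<close> by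
  \<open>dual_le\<close>, and off \<open>X\<close> zero at most on the graph of \<open>bar\<close>
  by \<open>dual_eqD\<close>.\<close>

definition excess :: "real \<Rightarrow> real \<Rightarrow> real" where
  "excess a y = (a - y)\<^sup>2 + p 1 a + psi 2 y + psi 3 y - l"

text \<open>The dual value is \<open>l * m\<close> minus this quantity. It is kept as a summand on
  the primal side to avoid truncated subtraction in \<open>ennreal\<close>.\<close>

definition potential :: ennreal where
  "potential = (\<Sum>j\<in>UNIV. \<integral>\<^sup>+x. ennreal (p j x) \<partial>mu j)"

definition primal :: ennreal where
  "primal = (\<integral>\<^sup>+a. ennreal (\<Sum>j\<in>UNIV. (S j (a + k j) - bar a)\<^sup>2) \<partial>leb {0..<m})"

lemma bar_meas [measurable]: "bar \<in> borel_measurable borel"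
  unfolding bar_def by measurable

lemma psi_meas [measurable]: "psi j \<in> borel_measurable borel"
  using psi_cont by (rule borel_measurable_continuous_onI)

lemma sets_mu [simp, measurable_cong]: "sets (mu j) = sets borel"
  by (simp add: mu_def)

lemma sets_nu [simp, measurable_cong]: "sets nu = sets borel"
  by (simp add: nu_def)

text \<open>Continuity in the first variable makes sublevel sets open; continuity in the second
  makes the minimum over a compact set of targets attained.\<close>

lemma excess_cont: "continuous_on UNIV (\<lambda>z. excess (fst z) (snd z))"
  unfolding excess_def
  by (intro continuous_intros continuous_on_compose2[OF p_cont] continuous_on_compose2[OF psi_cont]) auto

lemma excess_meas [measurable]: "(\<lambda>z. excess (fst z) (snd z)) \<in> borel_measurable borel"
  using excess_cont by (rule borel_measurable_continuous_onI)

lemma l_nonneg: "0 \<le> l"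
  using tight[of 0] m_pos p_nonneg by (auto intro!: sum_nonneg add_nonneg_nonneg simp flip: tight[of 0])

lemma AE_mu: "AE x in mu j. x \<in> A j"
  unfolding mu_def by (subst AE_distr_iff) (auto simp: AE_leb S_A)

lemma nn_integral_window_le:
  assumes [measurable]: "f \<in> borel_measurable borel"
  shows "(\<integral>\<^sup>+a. f (S j (a + k j)) \<partial>leb {0..<m}) \<le> integral\<^sup>N (mu j) f"
proof -
  have "(\<integral>\<^sup>+a. f (S j (a + k j)) \<partial>leb {0..<m}) = (\<integral>\<^sup>+a. f (S j a) * indicator {k j..<k j + m} a \<partial>lborel)"
    by (subst nn_integral_leb_shift[symmetric]) (simp_all add: nn_integral_leb)
  also have "\<dots> \<le> (\<integral>\<^sup>+a. f (S j a) * indicator {0..<M} a \<partial>lborel)"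
    using k_nonneg[of j] k_le[of j] by (intro nn_integral_mono) (auto simp: indicator_def)
  finally show ?thesis by (simp add: mu_def nn_integral_distr nn_integral_leb)
qed

lemma nn_integral_p: "(\<integral>\<^sup>+x. ennreal (p j x) \<partial>mu j) = (\<integral>\<^sup>+a. ennreal (p j (S j (a + k j))) \<partial>leb {0..<m})"
proof -
  have "(\<integral>\<^sup>+x. ennreal (p j x) \<partial>mu j) = (\<integral>\<^sup>+a. ennreal (p j (S j a)) * indicator {0..<M} a \<partial>lborel)"
    by (simp add: mu_def nn_integral_distr nn_integral_leb)
  also have "\<dots> = (\<integral>\<^sup>+a. ennreal (p j (S j a)) * indicator {k j..<k j + m} a \<partial>lborel)"
    using k_nonneg[of j] k_le[of j] slack[of _ j]
    by (intro nn_integral_cong) (auto simp: indicator_def)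
  also have "\<dots> = (\<integral>\<^sup>+a. ennreal (p j (S j (a + k j))) \<partial>leb {0..<m})"
    by (subst nn_integral_leb_shift[symmetric]) (simp_all add: nn_integral_leb)
  finally show ?thesis .
qed

lemma marg_le: "distr (leb {0..<m}) borel (\<lambda>a. S j (a + k j)) \<le> mu j"
proof (rule distr_leI)
  fix E :: "real set" assume [measurable]: "E \<in> sets borel"
  have "emeasure (distr (leb {0..<m}) borel (\<lambda>a. S j (a + k j))) E
      = (\<integral>\<^sup>+x. indicator E x \<partial>distr (leb {0..<m}) borel (\<lambda>a. S j (a + k j)))"
    by simp
  also have "\<dots> = (\<integral>\<^sup>+a. indicator E (S j (a + k j)) \<partial>leb {0..<m})"
    by (rule nn_integral_distr) auto
  also have "\<dots> \<le> emeasure (mu j) E"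
    using nn_integral_window_le[of "indicator E" j] by simp
  finally show "emeasure (distr (leb {0..<m}) borel (\<lambda>a. S j (a + k j))) E \<le> emeasure (mu j) E" .
qed auto

lemma mass_leb: "emeasure (leb {0..<m}) UNIV = ennreal m"
  using m_pos by (simp add: emeasure_leb)

lemma mass_nu: "mass nu = ennreal m"
  by (simp add: mass_def nu_def emeasure_distr mass_leb)

text \<open>Strong duality: \<open>tight\<close> holds at each parameter, and integrating it over an
  interval of length m gives the value.\<close>

lemma primal_potential: "primal + potential = ennreal (l * m)"
proof -
  have "primal + potential = (\<integral>\<^sup>+a. ennreal (\<Sum>j\<in>UNIV. (S j (a + k j) - bar a)\<^sup>2)
      + (\<Sum>j\<in>UNIV. ennreal (p j (S j (a + k j)))) \<partial>leb {0..<m})"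
    unfolding primal_def potential_def nn_integral_p
    by (subst nn_integral_add) (auto simp: nn_integral_sum)
  also have "\<dots> = (\<integral>\<^sup>+a. ennreal l \<partial>leb {0..<m})"
  proof (rule nn_integral_cong_AE)
    have "ennreal (\<Sum>j\<in>UNIV. (S j (a + k j) - bar a)\<^sup>2) + (\<Sum>j\<in>UNIV. ennreal (p j (S j (a + k j)))) = ennreal l"
      if "a \<in> {0..<m}" for a
      using tight[OF that] p_nonneg
      by (simp add: sum.distrib bar_def sum_nonneg flip: ennreal_plus)
    then show "AE a in leb {0..<m}. ennreal (\<Sum>j\<in>UNIV. (S j (a + k j) - bar a)\<^sup>2)
        + (\<Sum>j\<in>UNIV. ennreal (p j (S j (a + k j)))) = ennreal l"
      by (simp add: AE_leb)
  qed
  also have "\<dots> = ennreal (l * m)"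
    using l_nonneg m_pos by (simp add: mass_leb ennreal_mult)
  finally show ?thesis .
qed

lemma primal_finite: "primal < \<infinity>" and potential_finite: "potential < \<infinity>"
  using primal_potential by (metis ennreal_add_eq_top ennreal_neq_top infinity_ennreal_def less_top)+

text \<open>Boundedness of \<open>bar\<close> gives the second moment; \<open>null_vimage\<close> is
  absolute continuity expressed in the parameter.\<close>

lemma nu_P_ac: "nu \<in> P_ac m"
proof -
  have R: "\<bar>bar a\<bar> \<le> R" if "a \<in> {0..<m}" for a
  proof -
    have "\<bar>S j (a + k j)\<bar> \<le> R" for j
      using that k_nonneg[of j] k_le[of j] by (intro S_bounded) auto
    from this[of 1] this[of 2] this[of 3] show ?thesis
      by (simp add: bar_def sum_3)
  qed
  have "second_moment nu = (\<integral>\<^sup>+a. ennreal ((bar a)\<^sup>2) \<partial>leb {0..<m})"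
    by (simp add: second_moment_def nu_def nn_integral_distr)
  also have "\<dots> \<le> (\<integral>\<^sup>+a. ennreal (R\<^sup>2) \<partial>leb {0..<m})"
    using R by (intro nn_integral_mono_AE) (auto simp: AE_leb abs_le_square_iff[symmetric] intro!: AE_I2 ennreal_leI order_trans[OF R])
  also have "\<dots> < \<infinity>"
    by (simp add: mass_leb ennreal_mult_less_top)
  finally have "second_moment nu < \<infinity>" .
  moreover have "absolutely_continuous lborel nu"
    unfolding absolutely_continuous_def
  proof
    fix N :: "real set" assume N: "N \<in> null_sets lborel"
    then have [measurable]: "N \<in> sets borel" by auto
    have "emeasure nu N = emeasure lborel ({0..<m} \<inter> (bar -` N))"
      using measurable_sets[OF bar_meas, of N]
      by (simp add: nu_def emeasure_distr emeasure_leb)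
    also have "{0..<m} \<inter> (bar -` N) = {a \<in> {0..<m}. (\<Sum>j\<in>UNIV. S j (a + k j)) / 3 \<in> N}"
      by (auto simp: bar_def)
    finally show "N \<in> null_sets nu"
      using null_vimage[OF N] by (auto simp: null_sets_def)
  qed
  ultimately show ?thesis by (simp add: P_ac_def mass_nu)
qed

section \<open>The barycenter problem: value, minimality and uniqueness\<close>

lemma MK2_nu_le: "(\<Sum>j\<in>UNIV. MK2 m (mu j) nu) \<le> primal"
proof -
  have "MK2 m (mu j) nu \<le> (\<integral>\<^sup>+a. ennreal ((S j (a + k j) - bar a)\<^sup>2) \<partial>leb {0..<m})" for j
  proof -
    \<comment> \<open>Each point of the window is sent to the barycenter with the same parameter.
      Feasibility is enough for the upper bound.\<close>
    define \<gamma> where "\<gamma> = distr (leb {0..<m}) borel (\<lambda>a. (S j (a + k j), bar a))"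
    have "distr \<gamma> borel fst \<le> mu j" "distr \<gamma> borel snd \<le> nu"
      using marg_le[of j] by (simp_all add: \<gamma>_def distr_distr comp_def nu_def)
    then have "\<gamma> \<in> {\<gamma> \<in> partial_couplings2 (mu j) nu. mass \<gamma> = ennreal m}"
      by (simp add: partial_couplings2_def mass_def \<gamma>_def emeasure_distr mass_leb)
    then have "MK2 m (mu j) nu \<le> (\<integral>\<^sup>+(x, y). ennreal (\<bar>x - y\<bar>\<^sup>2) \<partial>\<gamma>)"
      unfolding MK2_def by (rule INF_lower)
    also have "\<dots> = (\<integral>\<^sup>+a. ennreal ((S j (a + k j) - bar a)\<^sup>2) \<partial>leb {0..<m})"
      unfolding \<gamma>_def by (subst nn_integral_distr) (simp_all add: split_beta)
    finally show ?thesis .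
  qed
  then have "(\<Sum>j\<in>UNIV. MK2 m (mu j) nu) \<le> (\<Sum>j\<in>UNIV. \<integral>\<^sup>+a. ennreal ((S j (a + k j) - bar a)\<^sup>2) \<partial>leb {0..<m})"
    by (rule sum_mono)
  also have "\<dots> = primal"
    unfolding primal_def by (subst nn_integral_sum[symmetric]) (auto simp: sum_ennreal)
  finally show ?thesis .
qed

lemma AE_coupling_fst:
  assumes "\<gamma> \<in> partial_couplings2 (mu j) \<nu>"
  shows "AE z in \<gamma>. fst z \<in> A j"
proof -
  have [measurable_cong]: "sets \<gamma> = sets borel" and le: "distr \<gamma> borel fst \<le> mu j"
    using assms by (auto simp: partial_couplings2_def)
  have "AE x in distr \<gamma> borel fst. x \<in> A j"
    by (rule AE_measure_le[OF _ le AE_mu]) simp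
  then show ?thesis by (subst (asm) AE_distr_iff) auto
qed

text \<open>Weak duality with the slack retained. Since the three couplings share the second
  marginal, the integrals of \<open>psi 2\<close> and \<open>psi 3\<close> move to the first
  coupling, where the dual constraint can be applied pointwise.\<close>

lemma coupling_lower_bound:
  assumes \<nu>: "sets \<nu> = sets borel" "mass \<nu> = ennreal m"
    and \<gamma>: "\<And>j. \<gamma> j \<in> partial_couplings2 (mu j) \<nu>" "\<And>j. mass (\<gamma> j) = ennreal m"
  shows "ennreal (l * m) + (\<integral>\<^sup>+z. ennreal (excess (fst z) (snd z)) \<partial>\<gamma> 1)
    \<le> (\<Sum>j\<in>UNIV. \<integral>\<^sup>+(x, y). ennreal (\<bar>x - y\<bar>\<^sup>2) \<partial>\<gamma> j) + potential"
proof -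
  have sets_\<gamma> [measurable_cong]: "sets (\<gamma> j) = sets borel" and fst_le: "distr (\<gamma> j) borel fst \<le> mu j" for j
    using \<gamma>(1)[of j] by (auto simp: partial_couplings2_def)
  define D where "D j z = ennreal ((fst z - snd z)\<^sup>2) + ennreal (p j (fst z))" for j and z :: "real \<times> real"
  have [measurable]: "D j \<in> borel_measurable borel" for j
    unfolding D_def by measurable
  have snd_eq: "distr (\<gamma> j) borel snd = \<nu>" for j
    using \<gamma>(1)[of j] \<nu> \<gamma>(2)[of j] by (intro partial_couplings2_snd) auto
  \<comment> \<open>The first marginal is dominated by \<open>mu j\<close>, so the price integrates
    to at most its share of \<open>potential\<close>.\<close>
  have D_le: "integral\<^sup>N (\<gamma> j) (D j)
    \<le> (\<integral>\<^sup>+(x, y). ennreal (\<bar>x - y\<bar>\<^sup>2) \<partial>\<gamma> j) + (\<integral>\<^sup>+x. ennreal (p j x) \<partial>mu j)" for j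
  proof -
    have "integral\<^sup>N (\<gamma> j) (D j) = (\<integral>\<^sup>+(x, y). ennreal (\<bar>x - y\<bar>\<^sup>2) \<partial>\<gamma> j) + (\<integral>\<^sup>+z. ennreal (p j (fst z)) \<partial>\<gamma> j)"
      unfolding D_def by (subst nn_integral_add) (simp_all add: case_prod_unfold)
    also have "(\<integral>\<^sup>+z. ennreal (p j (fst z)) \<partial>\<gamma> j) = (\<integral>\<^sup>+x. ennreal (p j x) \<partial>distr (\<gamma> j) borel fst)"
      by (subst nn_integral_distr) auto
    also have "\<dots> \<le> (\<integral>\<^sup>+x. ennreal (p j x) \<partial>mu j)"
      by (rule nn_integral_mono_measure_le[OF _ fst_le]) simp
    finally show ?thesis by (simp add: add_left_mono)
  qed
  have psi_le_D: "(\<integral>\<^sup>+z. ennreal (psi j (snd z)) \<partial>\<gamma> 1) \<le> integral\<^sup>N (\<gamma> j) (D j)" if "j \<noteq> 1" for j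
  proof -
    have "(\<integral>\<^sup>+z. ennreal (psi j (snd z)) \<partial>\<gamma> i) = (\<integral>\<^sup>+y. ennreal (psi j y) \<partial>\<nu>)" for i
      unfolding snd_eq[of i, symmetric] by (subst nn_integral_distr) auto
    then have "(\<integral>\<^sup>+z. ennreal (psi j (snd z)) \<partial>\<gamma> 1) = (\<integral>\<^sup>+z. ennreal (psi j (snd z)) \<partial>\<gamma> j)"
      by simp
    also have "\<dots> \<le> integral\<^sup>N (\<gamma> j) (D j)"
      using AE_coupling_fst[OF \<gamma>(1)[of j]]
      by (intro nn_integral_mono_AE, elim AE_mp)
        (auto simp: D_def p_nonneg simp flip: ennreal_plus intro!: ennreal_leI psi_le[OF that])
    finally show ?thesis .
  qed
  have "ennreal (l * m) + (\<integral>\<^sup>+z. ennreal (excess (fst z) (snd z)) \<partial>\<gamma> 1)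
      = (\<integral>\<^sup>+z. ennreal l + ennreal (excess (fst z) (snd z)) \<partial>\<gamma> 1)"
    using l_nonneg m_pos \<gamma>(2)[of 1] by (subst nn_integral_add) (auto simp: mass_def ennreal_mult)
  \<comment> \<open>On \<open>A 1\<close> the excess is nonnegative, so \<open>ennreal\<close> does
    not truncate it and the two integrands agree there.\<close>
  also have "\<dots> \<le> (\<integral>\<^sup>+z. D 1 z + (ennreal (psi 2 (snd z)) + ennreal (psi 3 (snd z))) \<partial>\<gamma> 1)"
    using AE_coupling_fst[OF \<gamma>(1)[of 1]] dual_le
    by (intro nn_integral_mono_AE, elim AE_mp)
      (auto simp: D_def A1 p_nonneg psi_nonneg l_nonneg excess_def simp flip: ennreal_plus intro!: AE_I2 ennreal_leI)
  also have "\<dots> = integral\<^sup>N (\<gamma> 1) (D 1) + ((\<integral>\<^sup>+z. ennreal (psi 2 (snd z)) \<partial>\<gamma> 1) + (\<integral>\<^sup>+z. ennreal (psi 3 (snd z)) \<partial>\<gamma> 1))"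
    by (simp add: nn_integral_add)
  also have "\<dots> \<le> integral\<^sup>N (\<gamma> 1) (D 1) + (integral\<^sup>N (\<gamma> 2) (D 2) + integral\<^sup>N (\<gamma> 3) (D 3))"
    by (intro add_left_mono add_mono psi_le_D) auto
  also have "\<dots> = (\<Sum>j\<in>UNIV. integral\<^sup>N (\<gamma> j) (D j))"
    by (simp add: sum_3 add.assoc)
  also have "\<dots> \<le> (\<Sum>j\<in>UNIV. (\<integral>\<^sup>+(x, y). ennreal (\<bar>x - y\<bar>\<^sup>2) \<partial>\<gamma> j) + (\<integral>\<^sup>+x. ennreal (p j x) \<partial>mu j))"
    by (rule sum_mono) (rule D_le)
  finally show ?thesis
    by (simp add: sum.distrib potential_def)
qed

text \<open>Each of the three infima is approached within e/3. Only the coupling of the first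
  measure is returned, as it carries the excess.\<close>

lemma near_optimal_coupling:
  assumes \<nu>: "sets \<nu> = sets borel" "mass \<nu> = ennreal m"
    and fin: "(\<Sum>j\<in>UNIV. MK2 m (mu j) \<nu>) < \<infinity>" and "0 < (e :: real)"
  obtains \<gamma> where "\<gamma> \<in> partial_couplings2 (mu 1) \<nu>" "mass \<gamma> = ennreal m"
    "ennreal (l * m) + (\<integral>\<^sup>+z. ennreal (excess (fst z) (snd z)) \<partial>\<gamma>)
      \<le> (\<Sum>j\<in>UNIV. MK2 m (mu j) \<nu>) + potential + ennreal e"
proof -
  have "\<exists>\<gamma>. \<gamma> \<in> partial_couplings2 (mu j) \<nu> \<and> mass \<gamma> = ennreal m \<and>
    (\<integral>\<^sup>+(x, y). ennreal (\<bar>x - y\<bar>\<^sup>2) \<partial>\<gamma>) \<le> MK2 m (mu j) \<nu> + ennreal (e / 3)" for j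
  proof -
    have "MK2 m (mu j) \<nu> < \<infinity>"
      using fin by (simp add: less_top)
    then have "MK2 m (mu j) \<nu> < MK2 m (mu j) \<nu> + ennreal (e / 3)"
      using \<open>0 < e\<close> by (cases "MK2 m (mu j) \<nu>") (auto simp: ennreal_less_iff simp flip: ennreal_plus)
    then show ?thesis
      unfolding MK2_def by (auto simp: INF_less_iff intro: less_imp_le)
  qed
  then obtain \<gamma> where \<gamma>: "\<And>j. \<gamma> j \<in> partial_couplings2 (mu j) \<nu>" "\<And>j. mass (\<gamma> j) = ennreal m"
    "\<And>j. (\<integral>\<^sup>+(x, y). ennreal (\<bar>x - y\<bar>\<^sup>2) \<partial>\<gamma> j) \<le> MK2 m (mu j) \<nu> + ennreal (e / 3)"
    by metis
  have "ennreal (l * m) + (\<integral>\<^sup>+z. ennreal (excess (fst z) (snd z)) \<partial>\<gamma> 1)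
    \<le> (\<Sum>j\<in>UNIV. \<integral>\<^sup>+(x, y). ennreal (\<bar>x - y\<bar>\<^sup>2) \<partial>\<gamma> j) + potential"
    by (rule coupling_lower_bound[OF \<nu> \<gamma>(1,2)])
  also have "\<dots> \<le> (\<Sum>j\<in>UNIV. MK2 m (mu j) \<nu> + ennreal (e / 3)) + potential"
    by (intro add_right_mono sum_mono \<gamma>(3))
  also have "\<dots> = (\<Sum>j\<in>UNIV. MK2 m (mu j) \<nu>) + potential + (\<Sum>j\<in>(UNIV::3 set). ennreal (e / 3))"
    by (simp add: sum.distrib ac_simps)
  also have "(\<Sum>j\<in>(UNIV::3 set). ennreal (e / 3)) = ennreal e"
    using \<open>0 < e\<close> by (subst sum_ennreal) auto
  finally show ?thesis using \<gamma> that by blast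
qed

lemma MK2_sum_ge:
  assumes \<nu>: "sets \<nu> = sets borel" "mass \<nu> = ennreal m"
  shows "ennreal (l * m) \<le> (\<Sum>j\<in>UNIV. MK2 m (mu j) \<nu>) + potential"
proof (rule ennreal_le_epsilon)
  \<comment> \<open>The right-hand side may be assumed finite here, which supplies the finiteness
    required by \<open>near_optimal_coupling\<close>.\<close>
  fix e :: real assume "(\<Sum>j\<in>UNIV. MK2 m (mu j) \<nu>) + potential < top" "0 < e"
  moreover from this have "(\<Sum>j\<in>UNIV. MK2 m (mu j) \<nu>) < \<infinity>" by auto
  ultimately obtain \<gamma> where "ennreal (l * m) + (\<integral>\<^sup>+z. ennreal (excess (fst z) (snd z)) \<partial>\<gamma>)
      \<le> (\<Sum>j\<in>UNIV. MK2 m (mu j) \<nu>) + potential + ennreal e"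
    using near_optimal_coupling[OF \<nu>, of e] by metis
  then show "ennreal (l * m) \<le> (\<Sum>j\<in>UNIV. MK2 m (mu j) \<nu>) + potential + ennreal e"
    by (rule order_trans[rotated]) simp
qed

lemma MK2_sum_ge_nu:
  assumes "sets \<nu> = sets borel" "mass \<nu> = ennreal m"
  shows "(\<Sum>j\<in>UNIV. MK2 m (mu j) nu) \<le> (\<Sum>j\<in>UNIV. MK2 m (mu j) \<nu>)"
proof -
  have "potential + primal \<le> potential + (\<Sum>j\<in>UNIV. MK2 m (mu j) \<nu>)"
    using MK2_sum_ge[OF assms] primal_potential by (simp add: add.commute)
  then have "primal \<le> (\<Sum>j\<in>UNIV. MK2 m (mu j) \<nu>)"
    using potential_finite by (auto simp: ennreal_add_left_cancel_le)
  with MK2_nu_le show ?thesis by (rule order_trans)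
qed

text \<open>
  The infimum in \<open>MK2\<close> need not be attained for a competitor \<open>\<nu>\<close>, so complementary slackness is
  applied to near-optimal couplings: up to mass \<open>e / d\<close> they live where the excess is below \<open>d\<close>.
  Letting \<open>e\<close>, then \<open>d\<close>, tend to 0 over a compact set of targets leaves only the graph of \<open>bar\<close>.
\<close>

lemma minimizer_le_compact:
  assumes \<nu>: "sets \<nu> = sets borel" "mass \<nu> = ennreal m"
    and opt: "(\<Sum>j\<in>UNIV. MK2 m (mu j) \<nu>) \<le> primal"
    and K: "compact K"
  shows "emeasure \<nu> K \<le> emeasure nu K"
proof -
  have [measurable]: "K \<in> sets borel" using K by (rule borel_compact)
  define U where "U d = (\<Union>y\<in>K. {a. excess a y < d})" for d
  have excess_cont1: "continuous_on UNIV (\<lambda>a. excess a y)" for y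
    by (rule continuous_on_compose2[OF excess_cont, of _ "\<lambda>a. (a, y)", simplified]) (auto intro!: continuous_intros)
  \<comment> \<open>The union over \<open>K\<close> may be uncountable; openness is what makes it
    measurable.\<close>
  have U_open: "open (U d)" for d
    unfolding U_def by (intro open_UN ballI open_Collect_less excess_cont1 continuous_intros)
  have [measurable]: "U d \<in> sets borel" for d using U_open by auto
  have bound: "emeasure \<nu> K \<le> emeasure (mu 1) (U d)" if "0 < d" for d
  proof (rule ennreal_le_epsilon)
    fix e :: real assume "0 < e"
    \<comment> \<open>The tolerance is \<open>e * d\<close> because Markov's inequality at level
      \<open>d\<close> divides it by \<open>d\<close>.\<close>
    then have "0 < e * d" using \<open>0 < d\<close> by simp
    have fin: "(\<Sum>j\<in>UNIV. MK2 m (mu j) \<nu>) < \<infinity>"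
      using opt primal_finite by (rule order_le_less_trans)
    obtain \<gamma> where \<gamma>: "\<gamma> \<in> partial_couplings2 (mu 1) \<nu>" "mass \<gamma> = ennreal m"
      "ennreal (l * m) + (\<integral>\<^sup>+z. ennreal (excess (fst z) (snd z)) \<partial>\<gamma>)
        \<le> (\<Sum>j\<in>UNIV. MK2 m (mu j) \<nu>) + potential + ennreal (e * d)"
      by (rule near_optimal_coupling[OF \<nu> fin \<open>0 < e * d\<close>])
    have sets_\<gamma> [measurable_cong]: "sets \<gamma> = sets borel" and fst_le: "distr \<gamma> borel fst \<le> mu 1"
      using \<gamma>(1) by (auto simp: partial_couplings2_def)
    have sp\<gamma>: "space \<gamma> = UNIV" using sets_eq_imp_space_eq[OF sets_\<gamma>] by simp
    have snd_eq: "distr \<gamma> borel snd = \<nu>"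
      using \<gamma> \<nu> by (intro partial_couplings2_snd) auto
    have "ennreal (l * m) + (\<integral>\<^sup>+z. ennreal (excess (fst z) (snd z)) \<partial>\<gamma>) \<le> primal + potential + ennreal (e * d)"
      by (rule order_trans[OF \<gamma>(3)]) (intro add_right_mono opt)
    then have exc: "(\<integral>\<^sup>+z. ennreal (excess (fst z) (snd z)) \<partial>\<gamma>) \<le> ennreal (e * d)"
      by (simp add: primal_potential ennreal_add_left_cancel_le)
    let ?B = "{z \<in> space \<gamma>. ennreal d \<le> ennreal (excess (fst z) (snd z))}"
    let ?C = "fst -` U d \<inter> space \<gamma>"
    have B: "?B \<in> sets \<gamma>" by measurable
    have C: "?C \<in> sets \<gamma>" by measurable
    have "emeasure \<nu> K = emeasure \<gamma> (snd -` K \<inter> space \<gamma>)"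
      by (subst snd_eq[symmetric]) (simp add: emeasure_distr)
    also have "\<dots> \<le> emeasure \<gamma> (?C \<union> ?B)"
      using B C \<open>0 < d\<close> by (intro emeasure_mono) (auto simp: U_def sp\<gamma> not_less intro!: ennreal_leI)
    also have "\<dots> \<le> emeasure \<gamma> ?C + emeasure \<gamma> ?B"
      using B C by (intro emeasure_subadditive)
    also have "emeasure \<gamma> ?C = emeasure (distr \<gamma> borel fst) (U d)"
      by (simp add: emeasure_distr)
    also have "\<dots> \<le> emeasure (mu 1) (U d)"
      using fst_le by (simp add: le_measure_iff le_fun_def mu_def split: if_splits)
    also have "emeasure \<gamma> ?B \<le> ennreal e"
    proof -
      have "ennreal d * emeasure \<gamma> ?B = (\<integral>\<^sup>+z. ennreal d * indicator ?B z \<partial>\<gamma>)"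
        using B by (simp add: nn_integral_cmult_indicator)
      also have "\<dots> \<le> (\<integral>\<^sup>+z. ennreal (excess (fst z) (snd z)) \<partial>\<gamma>)"
        by (intro nn_integral_mono) (auto simp: indicator_def)
      also have "\<dots> \<le> ennreal d * ennreal e"
        using exc \<open>0 < d\<close> \<open>0 < e\<close> by (simp add: ennreal_mult[symmetric] mult.commute)
      finally show ?thesis
        using \<open>0 < d\<close> by (simp add: ennreal_mult_le_mult_iff)
    qed
    finally show "emeasure \<nu> K \<le> emeasure (mu 1) (U d) + ennreal e"
      by (simp add: add_left_mono add_right_mono)
  qed
  define V where "V n = U (1 / real (Suc n))" for n
  have [measurable]: "V n \<in> sets borel" for n by (simp add: V_def)
  have V_dec: "decseq V"
  proof (unfold decseq_def, intro allI impI)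
    fix i n :: nat assume "i \<le> n"
    then have "1 / real (Suc n) \<le> 1 / real (Suc i)" by (intro frac_le) auto
    then show "V n \<subseteq> V i"
      unfolding V_def U_def by (blast intro: order_less_le_trans)
  qed
  have "emeasure (mu 1) UNIV < \<infinity>"
    using m_pos k_nonneg[of 1] k_le[of 1] by (simp add: mu_def emeasure_distr emeasure_leb)
  then have fin: "emeasure (mu 1) (V n) \<noteq> \<infinity>" for n
    using emeasure_mono[of "V n" UNIV "mu 1"] by (auto simp: top_unique)
  have "emeasure \<nu> K \<le> (INF n. emeasure (mu 1) (V n))"
    unfolding V_def by (intro INF_greatest bound) auto
  also have "\<dots> = emeasure (mu 1) (\<Inter>n. V n)"
    using V_dec fin by (intro INF_emeasure_decseq) auto
  also have "\<dots> = emeasure lborel ({0..<M} \<inter> (\<Inter>n. V n))"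
    by (simp add: mu_def S1 emeasure_distr emeasure_leb)
  \<comment> \<open>On \<open>X\<close> the equality case says nothing about \<open>bar\<close>;
    being finite, \<open>X\<close> adds no mass.\<close>
  also have "\<dots> \<le> emeasure lborel (({0..<m} \<inter> bar -` K) \<union> X)"
  proof (rule emeasure_mono)
    show "{0..<M} \<inter> (\<Inter>n. V n) \<subseteq> ({0..<m} \<inter> bar -` K) \<union> X"
    proof
      fix a assume a: "a \<in> {0..<M} \<inter> (\<Inter>n. V n)"
      then have aM: "a \<in> {0..<M}" by simp
      have "K \<noteq> {}" using a by (auto simp: V_def U_def)
      \<comment> \<open>Membership in all \<open>V n\<close> gives targets in \<open>K\<close> of
        arbitrarily small excess; compactness turns them into one target where the excess is at most
        0.\<close>
      have "continuous_on K (\<lambda>y. excess a y)"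
        by (rule continuous_on_compose2[OF excess_cont, of _ "\<lambda>y. (a, y)", simplified]) (auto intro!: continuous_intros)
      then obtain y where y: "y \<in> K" "\<And>z. z \<in> K \<Longrightarrow> excess a y \<le> excess a z"
        using continuous_attains_inf[OF K \<open>K \<noteq> {}\<close>] by metis
      have small: "excess a y < 1 / real (Suc n)" for n
        using a y by (auto simp: V_def U_def intro: order_le_less_trans dest!: spec[of _ n])
      have "excess a y \<le> 0"
      proof (rule ccontr)
        assume "\<not> excess a y \<le> 0"
        then obtain n where "inverse (real (Suc n)) < excess a y"
          using reals_Archimedean[of "excess a y"] by auto
        with small[of n] show False by (simp add: inverse_eq_divide)
      qed
      with dual_le[OF aM, of y] have "(a - y)\<^sup>2 + p 1 a + psi 2 y + psi 3 y = l"
        by (simp add: excess_def)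
      then have "a < m \<and> y = bar a" if "a \<notin> X"
        using dual_eqD[OF aM that] by (simp add: bar_def)
      with y(1) aM show "a \<in> ({0..<m} \<inter> bar -` K) \<union> X"
        by auto
    qed
  qed (use measurable_sets[OF bar_meas, of K] X_fin in \<open>auto simp: finite_imp_closed\<close>)
  also have "\<dots> \<le> emeasure lborel ({0..<m} \<inter> bar -` K) + emeasure lborel X"
    using measurable_sets[OF bar_meas, of K] X_fin
    by (intro emeasure_subadditive) (auto simp: finite_imp_closed)
  also have "\<dots> = emeasure nu K"
    using measurable_sets[OF bar_meas, of K] X_fin
    by (simp add: nu_def emeasure_distr emeasure_leb emeasure_lborel_countable countable_finite)
  finally show ?thesis .
qed

text \<open>Minimality of \<open>nu\<close> comes from duality. Any other minimizer is at most
  \<open>nu\<close> on compact sets and has the same finite mass, hence coincides with it.\<close>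

theorem partial_barycenters_eq: "partial_barycenters mu m = {nu}"
proof -
  have nuP: "sets nu = sets borel" "mass nu = ennreal m" by (simp_all add: mass_nu)
  have "\<nu> = nu" if "\<nu> \<in> P_ac m" "(\<Sum>j\<in>UNIV. MK2 m (mu j) \<nu>) \<le> (\<Sum>j\<in>UNIV. MK2 m (mu j) nu)" for \<nu>
  proof (rule measure_eqI_le_compact)
    have \<nu>: "sets \<nu> = sets borel" "mass \<nu> = ennreal m"
      using that(1) by (auto simp: P_ac_def)
    then show "sets \<nu> = sets borel" "sets nu = sets borel" by auto
    show "emeasure \<nu> (space \<nu>) = emeasure nu (space nu)" "emeasure nu (space nu) < \<infinity>"
      using \<nu>(2) mass_nu by (auto simp: mass_def)
    show "emeasure \<nu> K \<le> emeasure nu K" if "compact K" for K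
      using minimizer_le_compact[OF \<nu> order_trans[OF _ MK2_nu_le] that]
        \<open>(\<Sum>j\<in>UNIV. MK2 m (mu j) \<nu>) \<le> (\<Sum>j\<in>UNIV. MK2 m (mu j) nu)\<close> by blast
  qed
  then show ?thesis
    using nu_P_ac MK2_sum_ge_nu
    by (auto simp: partial_barycenters_def is_arg_min_linorder P_ac_def)
qed

section \<open>The multi-marginal problem: optimality of the plan and structure of all
  optimizers\<close>

definition sqdev :: "real ^ 3 \<Rightarrow> real" where
  "sqdev x = (\<Sum>j\<in>UNIV. (x $ j - (\<Sum>i\<in>UNIV. x $ i) / 3)\<^sup>2)"

lemma sqdev_nonneg: "0 \<le> sqdev x"
  unfolding sqdev_def by (intro sum_nonneg) auto

lemma sqdev_meas [measurable]: "sqdev \<in> borel_measurable borel"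
  unfolding sqdev_def by measurable

lemma plan_map_meas [measurable]: "(\<lambda>a. \<chi> j. S j (a + k j)) \<in> borel_measurable borel"
  by (intro borel_measurable_vec_lambda) measurable

lemma plan_feasible: "plan \<in> partial_couplings3 mu" "mass plan = ennreal m"
  using marg_le by (simp_all add: partial_couplings3_def plan_def distr_distr comp_def mass_def
    emeasure_distr mass_leb)

lemma plan_cost: "(\<integral>\<^sup>+x. ennreal (sqdev x) \<partial>plan) = primal"
  unfolding plan_def primal_def by (subst nn_integral_distr) (simp_all add: sqdev_def bar_def)

lemma cost_eq:
  assumes "sets \<sigma> = sets borel"
  shows "(\<integral>\<^sup>+x. ennreal (\<Sum>j\<in>UNIV. \<Sum>k\<in>UNIV - {j}. (x $ j - x $ k)\<^sup>2) \<partial>\<sigma>)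
    = 6 * (\<integral>\<^sup>+x. ennreal (sqdev x) \<partial>\<sigma>)"
proof -
  have [measurable_cong]: "sets \<sigma> = sets borel" by fact
  have "ennreal (\<Sum>j\<in>UNIV. \<Sum>k\<in>UNIV - {j}. (x $ j - x $ k)\<^sup>2) = 6 * ennreal (sqdev x)" for x :: "real ^ 3"
    unfolding sum_sqdist_eq_mean[of "\<lambda>j. x $ j"] sqdev_def[symmetric]
    by (subst ennreal_mult) (auto simp: sqdev_nonneg)
  then show ?thesis by (simp add: nn_integral_cmult)
qed

text \<open>The cost in \<open>Opt\<close> is 6 times \<open>sqdev\<close>, and a positive finite
  factor does not affect minimizers.\<close>

lemma Opt_iff:
  "\<sigma> \<in> Opt m mu \<longleftrightarrow> \<sigma> \<in> partial_couplings3 mu \<and> mass \<sigma> = ennreal m \<and>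
    (\<forall>\<tau>. \<tau> \<in> partial_couplings3 mu \<and> mass \<tau> = ennreal m \<longrightarrow>
      (\<integral>\<^sup>+x. ennreal (sqdev x) \<partial>\<sigma>) \<le> (\<integral>\<^sup>+x. ennreal (sqdev x) \<partial>\<tau>))"
  by (auto simp: Opt_def is_arg_min_linorder partial_couplings3_def cost_eq ennreal_mult_le_mult_iff)

lemma AE_plan_coord:
  assumes "\<sigma> \<in> partial_couplings3 mu" and "AE t in mu j. Q t"
  shows "AE x in \<sigma>. Q (x $ j)"
proof -
  have [measurable_cong]: "sets \<sigma> = sets borel" and le: "distr \<sigma> borel (\<lambda>x. x $ j) \<le> mu j"
    using assms(1) by (auto simp: partial_couplings3_def)
  have "AE t in distr \<sigma> borel (\<lambda>x. x $ j). Q t"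
    by (rule AE_measure_le[OF _ le assms(2)]) simp
  then show ?thesis by (rule AE_distrD[rotated]) measurable
qed

text \<open>The same weak duality, with the mean of the three coordinates as target y;
  \<open>psi_le\<close> is used at the second and third coordinates.\<close>

lemma plan_lower_bound:
  assumes \<sigma>: "\<sigma> \<in> partial_couplings3 mu" "mass \<sigma> = ennreal m"
  shows "ennreal (l * m) + (\<integral>\<^sup>+x. ennreal (excess (x $ 1) ((\<Sum>i\<in>UNIV. x $ i) / 3)) \<partial>\<sigma>)
    \<le> (\<integral>\<^sup>+x. ennreal (sqdev x) \<partial>\<sigma>) + potential"
proof -
  have [measurable_cong]: "sets \<sigma> = sets borel" and le: "\<And>j. distr \<sigma> borel (\<lambda>x. x $ j) \<le> mu j"
    using \<sigma>(1) by (auto simp: partial_couplings3_def)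
  have [measurable]: "p 1 \<in> borel_measurable borel" by (rule p_meas)
  have "(\<lambda>x :: real ^ 3. excess (x $ 1) ((\<Sum>i\<in>UNIV. x $ i) / 3)) \<in> borel_measurable borel"
    unfolding excess_def by measurable
  note [measurable] = this
  have AE_A: "AE x in \<sigma>. x $ j \<in> A j" for j
    by (rule AE_plan_coord[OF \<sigma>(1) AE_mu])
  have pointwise: "l + excess (x $ 1) ((\<Sum>i\<in>UNIV. x $ i) / 3) \<le> sqdev x + (\<Sum>j\<in>UNIV. p j (x $ j))"
    if "x $ 2 \<in> A 2" "x $ 3 \<in> A 3" for x :: "real ^ 3"
    using psi_le[of 2 "x $ 2" "(\<Sum>i\<in>UNIV. x $ i) / 3"] psi_le[of 3 "x $ 3" "(\<Sum>i\<in>UNIV. x $ i) / 3"] that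
    by (simp add: excess_def sqdev_def sum_3)
  have "ennreal (l * m) + (\<integral>\<^sup>+x. ennreal (excess (x $ 1) ((\<Sum>i\<in>UNIV. x $ i) / 3)) \<partial>\<sigma>)
      = (\<integral>\<^sup>+x. ennreal l + ennreal (excess (x $ 1) ((\<Sum>i\<in>UNIV. x $ i) / 3)) \<partial>\<sigma>)"
    using l_nonneg m_pos \<sigma>(2) by (subst nn_integral_add) (auto simp: mass_def ennreal_mult)
  also have "\<dots> \<le> (\<integral>\<^sup>+x. ennreal (sqdev x) + (\<Sum>j\<in>UNIV. ennreal (p j (x $ j))) \<partial>\<sigma>)"
  proof (rule nn_integral_mono_AE)
    show "AE x in \<sigma>. ennreal l + ennreal (excess (x $ 1) ((\<Sum>i\<in>UNIV. x $ i) / 3))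
        \<le> ennreal (sqdev x) + (\<Sum>j\<in>UNIV. ennreal (p j (x $ j)))"
      using AE_A[of 1] AE_A[of 2] AE_A[of 3]
    proof eventually_elim
      case (elim x)
      have "0 \<le> excess (x $ 1) ((\<Sum>i\<in>UNIV. x $ i) / 3)"
        using elim(1) dual_le by (simp add: A1 excess_def)
      with pointwise[OF elim(2,3)] show ?case
        by (simp add: p_nonneg sqdev_nonneg l_nonneg sum_nonneg ennreal_leI flip: ennreal_plus)
    qed
  qed
  also have "\<dots> = (\<integral>\<^sup>+x. ennreal (sqdev x) \<partial>\<sigma>) + (\<Sum>j\<in>UNIV. \<integral>\<^sup>+x. ennreal (p j (x $ j)) \<partial>\<sigma>)"
    by (subst nn_integral_add) (auto simp: nn_integral_sum)
  also have "\<dots> \<le> (\<integral>\<^sup>+x. ennreal (sqdev x) \<partial>\<sigma>) + potential"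
    unfolding potential_def
  proof (intro add_left_mono sum_mono)
    fix j :: 3
    have "(\<integral>\<^sup>+x. ennreal (p j (x $ j)) \<partial>\<sigma>) = (\<integral>\<^sup>+t. ennreal (p j t) \<partial>distr \<sigma> borel (\<lambda>x. x $ j))"
      by (subst nn_integral_distr) auto
    also have "\<dots> \<le> (\<integral>\<^sup>+t. ennreal (p j t) \<partial>mu j)"
      by (rule nn_integral_mono_measure_le[OF _ le]) simp
    finally show "(\<integral>\<^sup>+x. ennreal (p j (x $ j)) \<partial>\<sigma>) \<le> (\<integral>\<^sup>+t. ennreal (p j t) \<partial>mu j)" .
  qed
  finally show ?thesis .
qed

lemma plan_in_Opt: "plan \<in> Opt m mu"
proof -
  have "primal \<le> (\<integral>\<^sup>+x. ennreal (sqdev x) \<partial>\<sigma>)" if "\<sigma> \<in> partial_couplings3 mu" "mass \<sigma> = ennreal m" for \<sigma>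
  proof -
    have "potential + primal \<le> ennreal (l * m) + (\<integral>\<^sup>+x. ennreal (excess (x $ 1) ((\<Sum>i\<in>UNIV. x $ i) / 3)) \<partial>\<sigma>)"
      using primal_potential by (simp add: add.commute)
    also have "\<dots> \<le> potential + (\<integral>\<^sup>+x. ennreal (sqdev x) \<partial>\<sigma>)"
      using plan_lower_bound[OF that] by (simp add: add.commute)
    finally show ?thesis
      using potential_finite by (auto simp: ennreal_add_left_cancel_le)
  qed
  then show ?thesis
    using plan_feasible plan_cost by (simp add: Opt_iff)
qed

text \<open>Optimality forces the excess to integrate to 0, so it vanishes almost everywhere and
  \<open>dual_eqD\<close> fixes the mean of the coordinates. The exceptional set \<open>X\<close> is
  null because the first marginal is dominated by Lebesgue measure.\<close>

lemma AE_Opt: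
  assumes "\<sigma> \<in> Opt m mu"
  shows "AE x in \<sigma>. (\<forall>j. x $ j \<in> A j) \<and> x $ 1 \<notin> X \<and> x $ 1 < m \<and> (\<Sum>i\<in>UNIV. x $ i) / 3 = bar (x $ 1)"
proof -
  have \<sigma>: "\<sigma> \<in> partial_couplings3 mu" "mass \<sigma> = ennreal m"
    using assms by (auto simp: Opt_iff)
  have [measurable_cong]: "sets \<sigma> = sets borel"
    using \<sigma>(1) by (auto simp: partial_couplings3_def)
  have [measurable]: "p 1 \<in> borel_measurable borel" by (rule p_meas)
  have [measurable]: "(\<lambda>x :: real ^ 3. excess (x $ 1) ((\<Sum>i\<in>UNIV. x $ i) / 3)) \<in> borel_measurable borel"
    unfolding excess_def by measurable
  have "(\<integral>\<^sup>+x. ennreal (sqdev x) \<partial>\<sigma>) \<le> primal"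
    using assms plan_feasible plan_cost by (auto simp: Opt_iff)
  then have "(\<integral>\<^sup>+x. ennreal (sqdev x) \<partial>\<sigma>) + potential \<le> ennreal (l * m)"
    by (simp add: primal_potential[symmetric] add_right_mono)
  from order_trans[OF plan_lower_bound[OF \<sigma>] this]
  have "ennreal (l * m) + (\<integral>\<^sup>+x. ennreal (excess (x $ 1) ((\<Sum>i\<in>UNIV. x $ i) / 3)) \<partial>\<sigma>) \<le> ennreal (l * m) + 0"
    by simp
  then have "(\<integral>\<^sup>+x. ennreal (excess (x $ 1) ((\<Sum>i\<in>UNIV. x $ i) / 3)) \<partial>\<sigma>) = 0"
    unfolding ennreal_add_left_cancel_le by simp
  then have exc: "AE x in \<sigma>. ennreal (excess (x $ 1) ((\<Sum>i\<in>UNIV. x $ i) / 3)) = 0"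
    by (subst (asm) nn_integral_0_iff_AE) auto
  have [measurable]: "X \<in> sets borel" using X_fin by (simp add: finite_imp_closed)
  have "{t. t \<notin> X} \<in> sets borel" by measurable
  have "AE t in lborel. t \<notin> X"
    by (rule AE_not_in) (simp add: null_sets_def emeasure_lborel_countable countable_finite X_fin finite_imp_closed)
  then have "AE t in mu 1. t \<notin> X"
    using \<open>{t. t \<notin> X} \<in> sets borel\<close> unfolding mu_def S1
    by (subst AE_distr_iff) (auto simp: AE_leb elim: AE_mp)
  then have X: "AE x in \<sigma>. x $ 1 \<notin> X"
    by (rule AE_plan_coord[OF \<sigma>(1)])
  have AE_A: "AE x in \<sigma>. x $ j \<in> A j" for j
    by (rule AE_plan_coord[OF \<sigma>(1) AE_mu])
  have "AE x in \<sigma>. \<forall>j. x $ j \<in> A j"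
    using AE_A by (simp add: AE_all_countable)
  with exc X show ?thesis
  proof eventually_elim
    case (elim x)
    then have x1: "x $ 1 \<in> {0..<M}" using A1 by auto
    then have "(x $ 1 - (\<Sum>i\<in>UNIV. x $ i) / 3)\<^sup>2 + p 1 (x $ 1) + psi 2 ((\<Sum>i\<in>UNIV. x $ i) / 3) + psi 3 ((\<Sum>i\<in>UNIV. x $ i) / 3) = l"
      using elim(1) dual_le[OF x1] by (simp add: excess_def ennreal_eq_0_iff order_antisym)
    from dual_eqD[OF x1 elim(2) this] elim(2,3) show ?case by (simp add: bar_def)
  qed
qed

end

section \<open>The concrete measures, windows and prices\<close>

definition site :: "3 \<Rightarrow> real \<Rightarrow> real" where
  "site j a = (if j = 1 then a
    else if j = 2 then (if 1 \<le> a \<and> a < 2 then 0 else -2)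
    else (if a < 1 then -1 else if a < 2 then 1 else 0))"

definition site_range :: "3 \<Rightarrow> real set" where
  "site_range j = (if j = 1 then {0..<3} else if j = 2 then {-2, 0} else {-1, 0, 1})"

text \<open>Starting points of the windows at mass 1. The atoms in \<open>site\<close> are ordered
  so that the windows starting at 0 give the mass 2 matching, while \<open>[1,2)\<close> for the
  second and \<open>[2,3)\<close> for the third measure both carry the atom 0.\<close>

definition offset :: "3 \<Rightarrow> real" where
  "offset j = (if j = 1 then 0 else if j = 2 then 1 else 2)"

definition price :: "(real \<Rightarrow> real) \<Rightarrow> real \<Rightarrow> 3 \<Rightarrow> real \<Rightarrow> real" where
  "price f \<beta> j x = (if j = 1 then f x else if j = 2 \<and> x = 0 then \<beta> else 0)"

text \<open>For j = 2 and 3 this is the c-transform for the quadratic cost: the minimum over the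
  atoms x of \<open>(x - y)\<^sup>2\<close> plus the price of x.\<close>

definition price_conjugate :: "real \<Rightarrow> 3 \<Rightarrow> real \<Rightarrow> real" where
  "price_conjugate \<beta> j y = (if j = 2 then min ((y + 2)\<^sup>2) (y\<^sup>2 + \<beta>)
    else min (min ((y + 1)\<^sup>2) (y\<^sup>2)) ((y - 1)\<^sup>2))"

text \<open>
  The prices on the first measure are \<open>max 0 (l - d a)\<close>, where \<open>d a\<close> is the cheapest sum of squared
  deviations over \<open>b \<in> {-2, 0}\<close> and \<open>c \<in> {-1, 0, 1}\<close>, raised by the price \<open>\<beta>\<close> if \<open>b = 0\<close>.  At mass 1,
  \<open>\<beta> = 0\<close> and \<open>l = 2/3\<close> makes the price vanish at 1; at mass 2, \<open>\<beta> = 4\<close> makes the two triples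
  \<open>(1, -2, -1)\<close> and \<open>(1, 0, 1)\<close> equally expensive and \<open>l = 6\<close> makes the price vanish at 2.
\<close>

definition price1 :: "real \<Rightarrow> real" where
  "price1 a = max 0 (2/3 - 2/3 * a\<^sup>2)"

definition price2 :: "real \<Rightarrow> real" where
  "price2 a = max 0 (max (4 - 2 * a - 2/3 * a\<^sup>2) (4/3 + 2/3 * a - 2/3 * a\<^sup>2))"

lemma site_simps:
  "site 1 = (\<lambda>a. a)"
  "site 2 a = (if 1 \<le> a \<and> a < 2 then 0 else -2)"
  "site 3 a = (if a < 1 then -1 else if a < 2 then 1 else 0)"
  by (auto simp: site_def fun_eq_iff)

lemma site_range_simps:
  "site_range 1 = {0..<3}" "site_range 2 = {-2, 0}" "site_range 3 = {-1, 0, 1}"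
  by (auto simp: site_range_def)

lemma offset_simps: "offset 1 = 0" "offset 2 = 1" "offset 3 = 2"
  by (simp_all add: offset_def)

lemma price_simps: "price f \<beta> 1 = f" "price f \<beta> 2 x = (if x = 0 then \<beta> else 0)" "price f \<beta> 3 x = 0"
  by (auto simp: price_def fun_eq_iff)

lemma site_measurable [measurable]: "site j \<in> borel_measurable borel"
  using exhaust_3[of j] unfolding site_def by auto

section \<open>Pointwise verification of the dual constraints\<close>

lemma sum_sqdist_complete_square:
  fixes a b c y :: real
  shows "(a - y)\<^sup>2 + (b - y)\<^sup>2 + (c - y)\<^sup>2
    = 3 * (y - (a + b + c) / 3)\<^sup>2 + 2/3 * (a\<^sup>2 - a * (b + c) + b\<^sup>2 + c\<^sup>2 - b * c)"
  by (simp add: power2_eq_square field_simps)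

text \<open>Choosing atoms b and c that attain the two conjugates and completing the square in y
  leaves only six pairs (b, c) to check. Equality kills the square, which puts y at the
  mean.\<close>

lemma dual_reduction:
  fixes a y \<beta> v :: real
  assumes le: "\<And>b c. b \<in> {-2, 0} \<Longrightarrow> c \<in> {-1, 0, 1} \<Longrightarrow>
      v \<le> 2/3 * (a\<^sup>2 - a * (b + c) + b\<^sup>2 + c\<^sup>2 - b * c) + f a + (if b = 0 then \<beta> else 0)"
  defines "e \<equiv> (a - y)\<^sup>2 + f a + price_conjugate \<beta> 2 y + price_conjugate \<beta> 3 y"
  shows "v \<le> e"
    and "e = v \<Longrightarrow> \<exists>b\<in>{-2, 0}. \<exists>c\<in>{-1, 0, 1}. y = (a + b + c) / 3 \<and>
      2/3 * (a\<^sup>2 - a * (b + c) + b\<^sup>2 + c\<^sup>2 - b * c) + f a + (if b = 0 then \<beta> else 0) = v"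
proof -
  obtain b where b: "b \<in> {-2, 0}" "price_conjugate \<beta> 2 y = (b - y)\<^sup>2 + (if b = 0 then \<beta> else 0)"
  proof
    show "(if (y + 2)\<^sup>2 \<le> y\<^sup>2 + \<beta> then -2 else 0) \<in> {-2, 0 :: real}" by simp
  qed (auto simp: price_conjugate_def min_def power2_eq_square algebra_simps)
  obtain c where c: "c \<in> {-1, 0, 1}" "price_conjugate \<beta> 3 y = (c - y)\<^sup>2"
  proof
    show "(if (y + 1)\<^sup>2 \<le> y\<^sup>2 \<and> (y + 1)\<^sup>2 \<le> (y - 1)\<^sup>2 then -1
      else if y\<^sup>2 \<le> (y - 1)\<^sup>2 then 0 else 1) \<in> {-1, 0, 1 :: real}" by simp
  qed (auto simp: price_conjugate_def min_def power2_eq_square algebra_simps)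
  have e: "e = 3 * (y - (a + b + c) / 3)\<^sup>2
      + (2/3 * (a\<^sup>2 - a * (b + c) + b\<^sup>2 + c\<^sup>2 - b * c) + f a + (if b = 0 then \<beta> else 0))"
    using sum_sqdist_complete_square[of a y b c] b(2) c(2) by (simp add: e_def)
  have sq: "0 \<le> (y - (a + b + c) / 3)\<^sup>2" by simp
  show "v \<le> e" using le[OF b(1) c(1)] e sq by linarith
  assume "e = v"
  then have "(y - (a + b + c) / 3)\<^sup>2 = 0"
    and "2/3 * (a\<^sup>2 - a * (b + c) + b\<^sup>2 + c\<^sup>2 - b * c) + f a + (if b = 0 then \<beta> else 0) = v"
    using le[OF b(1) c(1)] e sq by linarith+
  with b(1) c(1) show "\<exists>b\<in>{-2, 0}. \<exists>c\<in>{-1, 0, 1}. y = (a + b + c) / 3 \<and>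
      2/3 * (a\<^sup>2 - a * (b + c) + b\<^sup>2 + c\<^sup>2 - b * c) + f a + (if b = 0 then \<beta> else 0) = v"
    by (intro bexI[of _ b] bexI[of _ c]) auto
qed

text \<open>With these bounds \<open>a\<^sup>2\<close> can be treated as a separate variable, and
  the case checks below become linear arithmetic.\<close>

lemma square_bounds:
  fixes a :: real
  assumes "0 \<le> a"
  shows "a \<le> 1 \<Longrightarrow> a\<^sup>2 \<le> 1" "1 < a \<Longrightarrow> a < a\<^sup>2" "2 \<le> a \<Longrightarrow> 2 * a \<le> a\<^sup>2"
  using assms by (auto simp: power2_eq_square mult_le_one mult_right_mono)

text \<open>The vacuous conditional below keeps the shape of \<open>dual_reduction\<close> at \<open>\<beta> = 0\<close>.\<close>

lemma dual_mass1:
  fixes a b c :: real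
  assumes "0 \<le> a" "b \<in> {-2, 0}" "c \<in> {-1, 0, 1}"
  defines "r \<equiv> 2/3 * (a\<^sup>2 - a * (b + c) + b\<^sup>2 + c\<^sup>2 - b * c) + price1 a + (if b = 0 then 0 else 0)"
  shows "2/3 \<le> r" and "r = 2/3 \<Longrightarrow> a \<noteq> 1 \<Longrightarrow> a < 1 \<and> b = 0 \<and> c = 0"
proof -
  have sq: "0 \<le> a\<^sup>2" "a \<le> 1 \<Longrightarrow> a\<^sup>2 \<le> 1" "1 < a \<Longrightarrow> a < a\<^sup>2" using square_bounds assms(1) by auto
  have pr: "0 \<le> price1 a" "2/3 - 2/3 * a\<^sup>2 \<le> price1 a" by (auto simp: price1_def)
  consider "a < 1" | "a = 1" | "1 < a" by linarith
  then have "2/3 \<le> r \<and> (r = 2/3 \<longrightarrow> a \<noteq> 1 \<longrightarrow> a < 1 \<and> b = 0 \<and> c = 0)"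
    using assms(2,3) unfolding r_def by cases (insert assms(1) sq pr, auto simp: add_divide_distrib diff_divide_distrib)
  then show "2/3 \<le> r" and "r = 2/3 \<Longrightarrow> a \<noteq> 1 \<Longrightarrow> a < 1 \<and> b = 0 \<and> c = 0" by auto
qed

text \<open>The polynomials in \<open>price2\<close> are 6 minus the costs of the triples (a, -2,
  -1) and (a, 0, 1), the latter including the price 4. The excluded points are a = 1, where they
  cross, and a = 2, where the price reaches 0.\<close>

lemma dual_mass2:
  fixes a b c :: real
  assumes "0 \<le> a" "b \<in> {-2, 0}" "c \<in> {-1, 0, 1}"
  defines "r \<equiv> 2/3 * (a\<^sup>2 - a * (b + c) + b\<^sup>2 + c\<^sup>2 - b * c) + price2 a + (if b = 0 then 4 else 0)"
  shows "6 \<le> r" and "r = 6 \<Longrightarrow> a \<noteq> 1 \<Longrightarrow> a \<noteq> 2 \<Longrightarrow> a < 2 \<and> b = site 2 a \<and> c = site 3 a"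
proof -
  have sq: "0 \<le> a\<^sup>2" "2 \<le> a \<Longrightarrow> 2 * a \<le> a\<^sup>2" using square_bounds assms(1) by auto
  have pr: "0 \<le> price2 a" "4 - 2 * a - 2/3 * a\<^sup>2 \<le> price2 a" "4/3 + 2/3 * a - 2/3 * a\<^sup>2 \<le> price2 a"
    by (auto simp: price2_def)
  consider "a < 1" | "a = 1" | "1 < a" "a < 2" | "2 \<le> a" by linarith
  then have "6 \<le> r \<and> (r = 6 \<longrightarrow> a \<noteq> 1 \<longrightarrow> a \<noteq> 2 \<longrightarrow> a < 2 \<and> b = site 2 a \<and> c = site 3 a)"
    using assms(2,3) unfolding r_def by cases (insert assms(1) sq pr, auto simp: site_simps add_divide_distrib diff_divide_distrib)
  then show "6 \<le> r" and "r = 6 \<Longrightarrow> a \<noteq> 1 \<Longrightarrow> a \<noteq> 2 \<Longrightarrow> a < 2 \<and> b = site 2 a \<and> c = site 3 a" by auto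
qed

section \<open>Verification of the two certificates\<close>

lemma null_sets_affine_vimage:
  fixes c t :: real
  assumes "c \<noteq> 0" "N \<in> null_sets lborel"
  shows "(\<lambda>a. t + c * a) -` N \<in> null_sets lborel"
proof -
  have [measurable]: "N \<in> sets borel" using assms(2) by auto
  have m: "(\<lambda>a. t + c * a) -` N \<in> sets borel"
    using measurable_sets[of "\<lambda>a. t + c * a" borel borel N] by simp
  have "0 = (\<integral>\<^sup>+x. indicator N x \<partial>lborel)" using assms(2) by auto
  also have "\<dots> = ennreal \<bar>c\<bar> * (\<integral>\<^sup>+a. indicator N (t + c * a) \<partial>lborel)"
    using assms(1) by (intro nn_integral_real_affine) auto
  also have "(\<integral>\<^sup>+a. indicator N (t + c * a) \<partial>lborel) = (\<integral>\<^sup>+a. indicator ((\<lambda>a. t + c * a) -` N) a \<partial>lborel)"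
    by (intro nn_integral_cong) (auto simp: indicator_def)
  also have "\<dots> = emeasure lborel ((\<lambda>a. t + c * a) -` N)" using m by simp
  finally show ?thesis using assms(1) m by (auto simp: null_sets_def)
qed

lemma price_conjugate_le:
  assumes "j \<noteq> 1" "x \<in> site_range j"
  shows "price_conjugate \<beta> j y \<le> (x - y)\<^sup>2 + price f \<beta> j x"
  using exhaust_3[of j] assms
  by (auto simp: price_conjugate_def price_def site_range_def power2_eq_square algebra_simps)

lemma price_conjugate_cont: "continuous_on UNIV (price_conjugate \<beta> j)"
  unfolding price_conjugate_def by (cases "j = 2") (auto intro!: continuous_intros)

lemma price_measurable:
  "f \<in> borel_measurable borel \<Longrightarrow> price f \<beta> j \<in> borel_measurable borel"
  using exhaust_3[of j] unfolding price_def by auto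

lemma price1_cont: "continuous_on UNIV price1" and price2_cont: "continuous_on UNIV price2"
  unfolding price1_def price2_def by (auto intro!: continuous_intros)

lemma bar1: "0 \<le> a \<Longrightarrow> a < 1 \<Longrightarrow> (\<Sum>j\<in>UNIV. site j (a + offset j)) / 3 = a / 3"
  by (simp add: sum_3 site_simps offset_simps)

lemma bar2: "0 \<le> a \<Longrightarrow> a < 2 \<Longrightarrow> (\<Sum>j\<in>UNIV. site j (a + 0)) / 3 = (if a < 1 then a / 3 - 1 else a / 3 + 1 / 3)"
  by (simp add: sum_3 site_simps)

lemma site_common:
  "a \<in> {0..<3} \<Longrightarrow> site j a \<in> site_range j" "a \<in> {0..<3} \<Longrightarrow> \<bar>site j a\<bar> \<le> 3" "site_range j \<in> sets borel"
  using exhaust_3[of j] by (auto simp: site_simps site_range_simps)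

text \<open>The active triple is (a, 0, 0), of cost 2/3 * a^2, which \<open>price1\<close> fills up
  to 2/3 on \<open>{0..<1}\<close>. The tie at 1 is where this price reaches 0.\<close>

lemma certificate1: "dual_certificate site site_range 3 1 (2/3) 3 offset (price price1 0) (price_conjugate 0) {1}"
proof
  fix a y :: real assume a: "a \<in> {0..<3}"
  note red = dual_reduction[of "2/3" a price1 0 y, OF dual_mass1(1)]
  show "2/3 \<le> (a - y)\<^sup>2 + price price1 0 1 a + price_conjugate 0 2 y + price_conjugate 0 3 y"
    using red(1) a by (simp add: price_simps)
  assume "a \<notin> {1}" "(a - y)\<^sup>2 + price price1 0 1 a + price_conjugate 0 2 y + price_conjugate 0 3 y = 2/3"
  then obtain b c where "b \<in> {-2, 0}" "c \<in> {-1, 0, 1}" "y = (a + b + c) / 3"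
    "2/3 * (a\<^sup>2 - a * (b + c) + b\<^sup>2 + c\<^sup>2 - b * c) + price1 a + (if b = 0 then 0 else 0) = 2/3"
    using red(2) a unfolding price_simps by (metis atLeastLessThan_iff)
  moreover from this have "a < 1 \<and> b = 0 \<and> c = 0"
    using dual_mass1(2)[of a b c] a \<open>a \<notin> {1}\<close> by simp
  ultimately show "a < 1 \<and> y = (\<Sum>j\<in>UNIV. site j (a + offset j)) / 3"
    using bar1[of a] a by simp
next
  fix a :: real assume a: "a \<in> {0..<1}"
  then have "a\<^sup>2 \<le> 1" using square_bounds(1) by auto
  with a show "(\<Sum>j\<in>UNIV. (site j (a + offset j) - (\<Sum>j\<in>UNIV. site j (a + offset j)) / 3)\<^sup>2
      + price price1 0 j (site j (a + offset j))) = 2/3"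
    using bar1[of a] by (simp add: sum_3 price_simps price1_def offset_simps site_simps)
      (simp add: power2_eq_square field_simps)
next
  fix N :: "real set" assume N: "N \<in> null_sets lborel"
  have "{a \<in> {0..<1}. (\<Sum>j\<in>UNIV. site j (a + offset j)) / 3 \<in> N} = {0..<1} \<inter> (\<lambda>a. 0 + 1/3 * a) -` N"
    using bar1 by auto
  also have "\<dots> \<in> null_sets lborel"
    by (rule null_set_Int1[OF null_sets_affine_vimage[OF _ N]]) auto
  finally show "{a \<in> {0..<1}. (\<Sum>j\<in>UNIV. site j (a + offset j)) / 3 \<in> N} \<in> null_sets lborel" .
next
  fix j :: 3 and a :: real
  assume "a \<in> {0..<3}" "a \<notin> {offset j..<offset j + 1}"
  moreover from this have "1 \<le> a\<^sup>2" if "j = 1" using that by (auto simp: offset_simps)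
  ultimately show "price price1 0 j (site j a) = 0"
    using exhaust_3[of j] by (auto simp: price_simps site_simps price1_def)
next
  fix j :: 3
  show "0 \<le> offset j" "offset j + 1 \<le> 3" by (auto simp: offset_def)
  show "price price1 0 j \<in> borel_measurable borel"
    using price1_cont by (intro price_measurable borel_measurable_continuous_onI)
  show "0 \<le> price price1 0 j x" "0 \<le> price_conjugate 0 j x" for x
    by (auto simp: price_def price1_def price_conjugate_def)
  show "price_conjugate 0 j y \<le> (x - y)\<^sup>2 + price price1 0 j x" if "j \<noteq> 1" "x \<in> site_range j" for x y
    using that by (rule price_conjugate_le)
qed (use price1_cont in \<open>simp_all add: price_simps site_common site_simps(1) site_range_simps(1) offset_simps price_conjugate_cont\<close>)

text \<open>All windows are \<open>[0,2)\<close>, which leaves out the interval \<open>[2,3)\<close>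
  carrying the atom 0 of the third measure.\<close>

lemma certificate2: "dual_certificate site site_range 3 2 6 3 (\<lambda>_. 0) (price price2 4) (price_conjugate 4) {1, 2}"
proof
  fix a y :: real assume a: "a \<in> {0..<3}"
  note red = dual_reduction[of 6 a price2 4 y, OF dual_mass2(1)]
  show "6 \<le> (a - y)\<^sup>2 + price price2 4 1 a + price_conjugate 4 2 y + price_conjugate 4 3 y"
    using red(1) a by (simp add: price_simps)
  assume "a \<notin> {1, 2}" "(a - y)\<^sup>2 + price price2 4 1 a + price_conjugate 4 2 y + price_conjugate 4 3 y = 6"
  then obtain b c where "b \<in> {-2, 0}" "c \<in> {-1, 0, 1}" "y = (a + b + c) / 3"
    "2/3 * (a\<^sup>2 - a * (b + c) + b\<^sup>2 + c\<^sup>2 - b * c) + price2 a + (if b = 0 then 4 else 0) = 6"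
    using red(2) a unfolding price_simps by (metis atLeastLessThan_iff)
  with dual_mass2(2)[of a b c] a \<open>a \<notin> {1, 2}\<close> show "a < 2 \<and> y = (\<Sum>j\<in>UNIV. site j (a + 0)) / 3"
    by (auto simp: sum_3 site_simps(1))
next
  fix a :: real assume a: "a \<in> {0..<2}"
  \<comment> \<open>The bounds on \<open>a * a\<close> make the outer \<open>max 0\<close> inactive;
    the two remaining polynomials change order at a = 1.\<close>
  have "a * a \<le> 1" if "a < 1" using a square_bounds(1)[of a] that by (simp add: power2_eq_square)
  moreover have "a * a \<le> 2 * a" using a by (intro mult_right_mono) auto
  ultimately have price2: "price2 a = (if a < 1 then 4 - 2 * a - 2/3 * a\<^sup>2 else 4/3 + 2/3 * a - 2/3 * a\<^sup>2)"
    using a by (auto simp: price2_def max_def power2_eq_square)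
  show "(\<Sum>j\<in>UNIV. (site j (a + 0) - (\<Sum>j\<in>UNIV. site j (a + 0)) / 3)\<^sup>2
      + price price2 4 j (site j (a + 0))) = 6"
    using a by (auto simp: sum_3 price_simps price2 site_simps) (auto simp: power2_eq_square field_simps)
next
  fix N :: "real set" assume N: "N \<in> null_sets lborel"
  have "{a \<in> {0..<2}. (\<Sum>j\<in>UNIV. site j (a + 0)) / 3 \<in> N}
      = ({0..<1} \<inter> (\<lambda>a. -1 + 1/3 * a) -` N) \<union> ({1..<2} \<inter> (\<lambda>a. 1/3 + 1/3 * a) -` N)"
    by (auto simp: bar2[unfolded add_0_right] add.commute split: if_splits)
  also have "\<dots> \<in> null_sets lborel"
    by (intro null_sets.Un null_set_Int1 null_sets_affine_vimage[OF _ N]) auto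
  finally show "{a \<in> {0..<2}. (\<Sum>j\<in>UNIV. site j (a + 0)) / 3 \<in> N} \<in> null_sets lborel" .
next
  fix j :: 3 and a :: real
  assume "a \<in> {0..<3}" "a \<notin> {0..<0 + 2}"
  \<comment> \<open>Beyond 2 this makes both polynomials in \<open>price2\<close> nonpositive, and
    the second measure sits at its free atom -2.\<close>
  moreover from this have "2 * a \<le> a\<^sup>2" using square_bounds(3)[of a] by auto
  ultimately show "price price2 4 j (site j a) = 0"
    using exhaust_3[of j] by (auto simp: price_simps site_simps price2_def)
next
  fix j :: 3
  show "price price2 4 j \<in> borel_measurable borel"
    using price2_cont by (intro price_measurable borel_measurable_continuous_onI)
  show "0 \<le> price price2 4 j x" "0 \<le> price_conjugate 4 j x" for x
    by (auto simp: price_def price2_def price_conjugate_def)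
  show "price_conjugate 4 j y \<le> (x - y)\<^sup>2 + price price2 4 j x" if "j \<noteq> 1" "x \<in> site_range j" for x y
    using that by (rule price_conjugate_le)
qed (use price2_cont in \<open>simp_all add: price_simps site_common site_simps(1) site_range_simps(1) price_conjugate_cont\<close>)

text \<open>\<open>mu\<close> depends only on \<open>S\<close> and \<open>M\<close>, which both
  interpretations share, so \<open>mass1.mu\<close> and \<open>mass2.mu\<close> are the same
  measures.\<close>

interpretation mass1: dual_certificate site site_range 3 1 "2/3" 3 offset "price price1 0" "price_conjugate 0" "{1}"
  by (rule certificate1)

interpretation mass2: dual_certificate site site_range 3 2 6 3 "\<lambda>_. 0" "price price2 4" "price_conjugate 4" "{1, 2}"
  by (rule certificate2)

section \<open>Failure of monotonicity between mass 1 and mass 2\<close>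

lemma marginals:
  "sets (mass1.mu j) = sets borel" "mass (mass1.mu j) = 3" "second_moment (mass1.mu j) < \<infinity>"
proof -
  show "sets (mass1.mu j) = sets borel" "mass (mass1.mu j) = 3"
    by (simp_all add: mass_def mass1.mu_def emeasure_distr emeasure_leb)
  have "second_moment (mass1.mu j) = (\<integral>\<^sup>+a. ennreal ((site j a)\<^sup>2) \<partial>leb {0..<3})"
    by (simp add: second_moment_def mass1.mu_def nn_integral_distr)
  also have "\<dots> \<le> (\<integral>\<^sup>+a. ennreal (3\<^sup>2) \<partial>leb {0..<3})"
  proof (rule nn_integral_mono_AE)
    have "(site j a)\<^sup>2 \<le> 3\<^sup>2" if "a \<in> {0..<3}" for a
      using site_common(2)[OF that, of j] by (intro abs_le_square_iff[THEN iffD1]) simp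
    then show "AE a in leb {0..<3}. ennreal ((site j a)\<^sup>2) \<le> ennreal (3\<^sup>2)"
      by (subst AE_leb, simp, intro AE_I2 impI ennreal_leI)
  qed
  also have "\<dots> < \<infinity>"
    by (simp add: emeasure_leb ennreal_mult_less_top)
  finally show "second_moment (mass1.mu j) < \<infinity>" .
qed

text \<open>The barycenters at mass 1 fill \<open>[0,1/3)\<close>, those at mass 2 fill
  \<open>[-1,-2/3)\<close> and \<open>[2/3,1)\<close>; the test set \<open>{0..1/3}\<close> has mass
  1 for the first and 0 for the second.\<close>

lemma barycenters_not_le: "\<not> mass1.nu \<le> mass2.nu"
proof
  assume "mass1.nu \<le> mass2.nu"
  then have le: "emeasure mass1.nu {0..1/3} \<le> emeasure mass2.nu {0..1/3}"
    by (simp add: le_measure_iff le_fun_def mass1.nu_def mass2.nu_def)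
  have "emeasure mass1.nu {0..1/3} = emeasure lborel ({0..<1} \<inter> mass1.bar -` {0..1/3})"
    using measurable_sets[OF mass1.bar_meas, of "{0..1/3}"]
    by (simp add: mass1.nu_def emeasure_distr emeasure_leb)
  also have "{0..<1} \<inter> mass1.bar -` {0..1/3} = {0..<1}"
    using bar1 by (auto simp: mass1.bar_def)
  finally have "emeasure mass1.nu {0..1/3} = 1" by simp
  moreover have "emeasure mass2.nu {0..1/3} = emeasure lborel ({0..<2} \<inter> mass2.bar -` {0..1/3})"
    using measurable_sets[OF mass2.bar_meas, of "{0..1/3}"]
    by (simp add: mass2.nu_def emeasure_distr emeasure_leb)
  moreover have "{0..<2} \<inter> mass2.bar -` {0..1/3} = {}"
    using bar2 by (auto simp: mass2.bar_def split: if_splits)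
  ultimately show False using le by simp
qed

text \<open>The mean determines the sum b + c of the second and third coordinates. At mass 1 it is
  0, which only (0, 0) achieves; at mass 2 it is -3 or 1, which only (-2, -1) and (0, 1) achieve. So
  the third marginal is entirely at 0 in one case and avoids 0 in the other.\<close>

lemma Opt_third_marginals_not_le:
  assumes "\<sigma> \<in> Opt 1 mass1.mu" "\<sigma>' \<in> Opt 2 mass1.mu"
  shows "\<not> distr \<sigma> borel (\<lambda>x. x $ 3) \<le> distr \<sigma>' borel (\<lambda>x. x $ 3)"
proof
  assume "distr \<sigma> borel (\<lambda>x. x $ 3) \<le> distr \<sigma>' borel (\<lambda>x. x $ 3)"
  then have le: "emeasure (distr \<sigma> borel (\<lambda>x. x $ 3)) {0} \<le> emeasure (distr \<sigma>' borel (\<lambda>x. x $ 3)) {0}"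
    by (simp add: le_measure_iff le_fun_def)
  have [measurable_cong]: "sets \<sigma> = sets borel" "sets \<sigma>' = sets borel" and mass: "mass \<sigma> = ennreal 1"
    using assms by (auto simp: Opt_def is_arg_min_def partial_couplings3_def)
  have sum: "(\<Sum>i\<in>UNIV. x $ i) = x $ 1 + x $ 2 + x $ 3" for x :: "real ^ 3"
    by (rule sum_3)
  have "AE x in \<sigma>. x $ 3 = 0"
    using mass1.AE_Opt[OF assms(1)]
  proof eventually_elim
    case (elim x)
    then have "x $ 1 \<in> {0..<3}" "x $ 2 \<in> {-2, 0}" "x $ 3 \<in> {-1, 0, 1}" "x $ 1 < 1"
      unfolding site_range_simps[symmetric] by auto
    with elim bar1[of "x $ 1"] show ?case by (auto simp: mass1.bar_def sum)
  qed
  then have "emeasure \<sigma> ((\<lambda>x. x $ 3) -` {0} \<inter> space \<sigma>) = emeasure \<sigma> (space \<sigma>)"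
    by (intro emeasure_eq_AE) (auto elim: AE_mp)
  moreover have "AE x in \<sigma>'. x $ 3 \<noteq> 0"
    using mass2.AE_Opt[OF assms(2)]
  proof eventually_elim
    case (elim x)
    then have "x $ 1 \<in> {0..<3}" "x $ 2 \<in> {-2, 0}" "x $ 3 \<in> {-1, 0, 1}" "x $ 1 < 2"
      unfolding site_range_simps[symmetric] by auto
    with elim bar2[of "x $ 1"] show ?case by (auto simp: mass2.bar_def sum split: if_splits)
  qed
  then have "emeasure \<sigma>' ((\<lambda>x. x $ 3) -` {0} \<inter> space \<sigma>') = emeasure \<sigma>' {}"
    by (intro emeasure_eq_AE) (auto elim: AE_mp)
  ultimately show False
    using le mass by (simp add: emeasure_distr mass_def)
qed

theorem proposition4p1:
  "\<exists>\<mu> :: 3 \<Rightarrow> real measure.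
     (\<forall>j. sets (\<mu> j) = sets borel \<and> mass (\<mu> j) < \<infinity> \<and> second_moment (\<mu> j) < \<infinity>) \<and>
     (\<exists>m m' \<nu> \<nu>'. 0 < m \<and> m < m' \<and> ennreal m' < (MIN j. mass (\<mu> j)) \<and>
        partial_barycenters \<mu> m = {\<nu>} \<and> partial_barycenters \<mu> m' = {\<nu>'} \<and>
        \<not> \<nu> \<le> \<nu>') \<and>
     (\<exists>m m'. 0 < m \<and> m < m' \<and> ennreal m' < (MIN j. mass (\<mu> j)) \<and>
        Opt m \<mu> \<noteq> {} \<and> Opt m' \<mu> \<noteq> {} \<and>
        (\<forall>\<sigma>\<in>Opt m \<mu>. \<forall>\<sigma>'\<in>Opt m' \<mu>.
           \<not> distr \<sigma> borel (\<lambda>x. x $ 3) \<le> distr \<sigma>' borel (\<lambda>x. x $ 3)))"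
proof (intro exI[of _ mass1.mu] conjI)
  \<comment> \<open>All three measures have mass 3, so the pair of masses 1 and 2 serves both
    claims.\<close>
  have mass_lt: "ennreal 2 < (MIN j. mass (mass1.mu j))"
    by (simp add: marginals)
  show "\<forall>j. sets (mass1.mu j) = sets borel \<and> mass (mass1.mu j) < \<infinity> \<and> second_moment (mass1.mu j) < \<infinity>"
    using marginals by (simp add: less_top)
  show "\<exists>m m' \<nu> \<nu>'. 0 < m \<and> m < m' \<and> ennreal m' < (MIN j. mass (mass1.mu j)) \<and>
      partial_barycenters mass1.mu m = {\<nu>} \<and> partial_barycenters mass1.mu m' = {\<nu>'} \<and> \<not> \<nu> \<le> \<nu>'"
    using mass_lt barycenters_not_le
    by (intro exI[of _ 1] exI[of _ 2] exI[of _ mass1.nu] exI[of _ mass2.nu])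
      (simp add: mass1.partial_barycenters_eq mass2.partial_barycenters_eq)
  show "\<exists>m m'. 0 < m \<and> m < m' \<and> ennreal m' < (MIN j. mass (mass1.mu j)) \<and>
      Opt m mass1.mu \<noteq> {} \<and> Opt m' mass1.mu \<noteq> {} \<and>
      (\<forall>\<sigma>\<in>Opt m mass1.mu. \<forall>\<sigma>'\<in>Opt m' mass1.mu.
        \<not> distr \<sigma> borel (\<lambda>x. x $ 3) \<le> distr \<sigma>' borel (\<lambda>x. x $ 3))"
    using mass_lt mass1.plan_in_Opt mass2.plan_in_Opt Opt_third_marginals_not_le
    by (intro exI[of _ 1] exI[of _ 2]) auto
qed

end
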